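(* Let $(Z_1,\rho_1)$ be a quasi-metric space that is uniformly perfect and doubling, let $(Z_2,\rho_2)$ be a quasi-metric space, and let $f:(Z_1,\rho_1)\to(Z_2,\rho_2)$ be a weakly quasimöbius map. Then $f$ is quasimöbius if and only if the image space $f(Z_1)$ (equipped with the restriction of $\rho_2$) is uniformly perfect and doubling.
   Context: A quasi-metric on a set $X$ is a symmetric function $\rho:X\times X\to[0,\infty)$ with $\rho(x,y)=0$ iff $x=y$ and, for some constant $K\ge 1$, $\rho(x,z)\le K\max\{\rho(x,y),\rho(y,z)\}$ for all $x,y,z\in X$. Balls are $B(x,r)=\{y\in X:\rho(x,y)<r\}$; the topology is the one in which a set $U$ is open iff every $x\in U$ has a ball $B(x,r)\subset U$ with $r>0$. A quasi-metric space is doubling if there is a constant $C$ such that every ball can be covered by at most $C$ balls of half its radius. It is uniformly perfect if there is $\tau\in(0,1)$ such that for each $x\in X$ and every $r>0$ with $X\setminus B(x,r)\ne\emptyset$ one has $B(x,r)\setminus B(x,\tau r)\neq\emptyset$. The cross ratio of points $a,b,c,d$ with $a\neq b$, $c\neq d$ in a quasi-metric space $(Z,\rho)$ is $r(a,b,c,d)=\dfrac{\rho(a,c)\rho(b,d)}{\rho(a,b)\rho(c,d)}$. Let $f:(Z_1,\rho_1)\to(Z_2,\rho_2)$ be an embedding (homeomorphism onto its image) between quasi-metric spaces. - $f$ is quasimöbius if there is a homeomorphism $\theta:[0,\infty)\to[0,\infty)$ such that $r(a,b,c,d)\le t$ implies $r(f(a),f(b),f(c),f(d))\le\theta(t)$,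 for all $a,b,c,d\in Z_1$ (with $a\ne b$, $c\neq d$) and $t\ge 0$. - $f$ is weakly quasimöbius if there exist constants $h>0$ and $H\ge1$ such that $r(a,b,c,d)\le h$ implies $r(f(a),f(b),f(c),f(d))\le H$ for all $a,b,c,d\in Z_1$ (with $a\ne b$, $c\neq d$). *)

theory Defs
  imports "HOL-Analysis.Analysis"
begin

text \<open>
  A quasi-metric space is a carrier set \<open>X\<close> together with a function \<open>\<rho>\<close> on the ambient type;
  only the values of \<open>\<rho>\<close> on \<open>X\<close> matter. In particular, a subset \<open>S \<subseteq> X\<close> with the restricted
  quasi-metric is the pair \<open>S\<close>, \<open>\<rho>\<close>.
\<close>

definition quasi_metric_space :: "'a set \<Rightarrow> ('a \<Rightarrow> 'a \<Rightarrow> real) \<Rightarrow> bool" where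
  "quasi_metric_space X \<rho> \<longleftrightarrow>
     (\<forall>x\<in>X. \<forall>y\<in>X. 0 \<le> \<rho> x y) \<and>
     (\<forall>x\<in>X. \<forall>y\<in>X. \<rho> x y = \<rho> y x) \<and>
     (\<forall>x\<in>X. \<forall>y\<in>X. \<rho> x y = 0 \<longleftrightarrow> x = y) \<and>
     (\<exists>K\<ge>1. \<forall>x\<in>X. \<forall>y\<in>X. \<forall>z\<in>X. \<rho> x z \<le> K * max (\<rho> x y) (\<rho> y z))"

definition qball :: "'a set \<Rightarrow> ('a \<Rightarrow> 'a \<Rightarrow> real) \<Rightarrow> 'a \<Rightarrow> real \<Rightarrow> 'a set" where
  "qball X \<rho> x r = {y \<in> X. \<rho> x y < r}"

text \<open>Balls need not be open in this topology.\<close>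

definition qtopology :: "'a set \<Rightarrow> ('a \<Rightarrow> 'a \<Rightarrow> real) \<Rightarrow> 'a topology" where
  "qtopology X \<rho> = topology (\<lambda>U. U \<subseteq> X \<and> (\<forall>x\<in>U. \<exists>r>0. qball X \<rho> x r \<subseteq> U))"

lemma openin_qtopology:
  "openin (qtopology X \<rho>) U \<longleftrightarrow> U \<subseteq> X \<and> (\<forall>x\<in>U. \<exists>r>0. qball X \<rho> x r \<subseteq> U)"
proof -
  let ?P = "\<lambda>U. U \<subseteq> X \<and> (\<forall>x\<in>U. \<exists>r>0. qball X \<rho> x r \<subseteq> U)"
  have "istopology ?P"
    unfolding istopology_def
  proof (intro conjI allI impI ballI)
    fix S T x assume S: "?P S" and T: "?P T" and x: "x \<in> S \<inter> T"
    obtain r where r: "r > 0" "qball X \<rho> x r \<subseteq> S" using S x by blast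
    obtain s where s: "s > 0" "qball X \<rho> x s \<subseteq> T" using T x by blast
    have "qball X \<rho> x (min r s) \<subseteq> S \<inter> T"
      using r(2) s(2) by (auto simp: qball_def)
    then show "\<exists>r>0. qball X \<rho> x r \<subseteq> S \<inter> T"
      using r(1) s(1) by (intro exI[of _ "min r s"]) auto
  next
    fix \<K> x assume \<K>: "\<forall>K\<in>\<K>. ?P K" and "x \<in> \<Union>\<K>"
    then obtain A where A: "A \<in> \<K>" "x \<in> A" by blast
    then obtain r where "r > 0" "qball X \<rho> x r \<subseteq> A" using \<K> by blast
    then show "\<exists>r>0. qball X \<rho> x r \<subseteq> \<Union>\<K>" using A(1) by blast
  qed blast+
  then show ?thesis by (simp add: qtopology_def topology_inverse')
qed

lemma topspace_qtopology [simp]: "topspace (qtopology X \<rho>) = X"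
proof -
  have "openin (qtopology X \<rho>) X"
    by (auto simp: openin_qtopology qball_def intro: exI[of _ 1])
  then show ?thesis
    by (metis openin_qtopology openin_subset openin_topspace subset_antisym)
qed

definition doubling :: "'a set \<Rightarrow> ('a \<Rightarrow> 'a \<Rightarrow> real) \<Rightarrow> bool" where
  "doubling X \<rho> \<longleftrightarrow>
     (\<exists>C::nat. \<forall>x\<in>X. \<forall>r>0. \<exists>F. F \<subseteq> X \<and> finite F \<and> card F \<le> C \<and>
        qball X \<rho> x r \<subseteq> (\<Union>y\<in>F. qball X \<rho> y (r / 2)))"

definition uniformly_perfect :: "'a set \<Rightarrow> ('a \<Rightarrow> 'a \<Rightarrow> real) \<Rightarrow> bool" where
  "uniformly_perfect X \<rho> \<longleftrightarrow>
     (\<exists>\<tau>. 0 < \<tau> \<and> \<tau> < 1 \<and>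
        (\<forall>x\<in>X. \<forall>r>0. X - qball X \<rho> x r \<noteq> {} \<longrightarrow> qball X \<rho> x r - qball X \<rho> x (\<tau> * r) \<noteq> {}))"

definition cross_ratio :: "('a \<Rightarrow> 'a \<Rightarrow> real) \<Rightarrow> 'a \<Rightarrow> 'a \<Rightarrow> 'a \<Rightarrow> 'a \<Rightarrow> real" where
  "cross_ratio \<rho> a b c d = (\<rho> a c * \<rho> b d) / (\<rho> a b * \<rho> c d)"

text \<open>
  In the next two definitions \<open>f\<close> is an embedding into \<open>Z2\<close>, that is, a homeomorphism onto its
  image with the subspace topology; \<^const>\<open>embedding_map\<close> entails \<open>f ` Z1 \<subseteq> Z2\<close> and injectivity
  of \<open>f\<close> on \<open>Z1\<close>.
\<close>

definition quasimobius ::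
  "'a set \<Rightarrow> ('a \<Rightarrow> 'a \<Rightarrow> real) \<Rightarrow> 'b set \<Rightarrow> ('b \<Rightarrow> 'b \<Rightarrow> real) \<Rightarrow> ('a \<Rightarrow> 'b) \<Rightarrow> bool" where
  "quasimobius Z1 \<rho>1 Z2 \<rho>2 f \<longleftrightarrow>
     embedding_map (qtopology Z1 \<rho>1) (qtopology Z2 \<rho>2) f \<and>
     (\<exists>\<theta> \<theta>'. homeomorphism {0::real..} {0::real..} \<theta> \<theta>' \<and>
        (\<forall>a\<in>Z1. \<forall>b\<in>Z1. \<forall>c\<in>Z1. \<forall>d\<in>Z1. \<forall>t\<ge>0. a \<noteq> b \<longrightarrow> c \<noteq> d \<longrightarrow>
           cross_ratio \<rho>1 a b c d \<le> t \<longrightarrow> cross_ratio \<rho>2 (f a) (f b) (f c) (f d) \<le> \<theta> t))"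

definition weakly_quasimobius ::
  "'a set \<Rightarrow> ('a \<Rightarrow> 'a \<Rightarrow> real) \<Rightarrow> 'b set \<Rightarrow> ('b \<Rightarrow> 'b \<Rightarrow> real) \<Rightarrow> ('a \<Rightarrow> 'b) \<Rightarrow> bool" where
  "weakly_quasimobius Z1 \<rho>1 Z2 \<rho>2 f \<longleftrightarrow>
     embedding_map (qtopology Z1 \<rho>1) (qtopology Z2 \<rho>2) f \<and>
     (\<exists>h>0. \<exists>H\<ge>1.
        (\<forall>a\<in>Z1. \<forall>b\<in>Z1. \<forall>c\<in>Z1. \<forall>d\<in>Z1. a \<noteq> b \<longrightarrow> c \<noteq> d \<longrightarrow>
           cross_ratio \<rho>1 a b c d \<le> h \<longrightarrow> cross_ratio \<rho>2 (f a) (f b) (f c) (f d) \<le> H))"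

end

theory Submission
  imports Defs
begin

text \<open>
  Uniform perfectness and doubling both have equivalent forms that only involve cross ratios, so a
  quasimoebius map carries them to its image. Conversely, pull \<open>\<rho>2\<close> back to \<open>Z1\<close>, and write the
  cross ratio of \<open>a, b, c, d\<close> as \<open>g c / g b\<close> with \<open>g x = \<rho> a x / \<rho> d x\<close>. If it is bounded for \<open>\<rho>1\<close> but
  huge for \<open>\<rho>2\<close>, uniform perfectness of the image yields many points between \<open>b\<close> and \<open>c\<close> at
  geometrically growing values of \<open>g\<close> for \<open>\<rho>2\<close>. The weak quasimoebius condition makes all cross
  ratios of these points bounded for \<open>\<rho>1\<close>, so doubling of \<open>Z1\<close> bounds their number. Hence every
  bound on cross ratios is turned into a bound; the inverse map is weakly quasimoebius too, so this
  holds in both directions. Chaining through uniform perfectness gives power bounds in both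
  directions, which combine to \<open>\<theta> t = (A t)^n + 4 t^(1/n)\<close>.
\<close>

section \<open>Moebius forms of uniform perfectness and doubling\<close>

locale quasi_metric =
  fixes Z :: "'a set" and \<rho> :: "'a \<Rightarrow> 'a \<Rightarrow> real" and K :: real
  assumes nonneg: "x \<in> Z \<Longrightarrow> y \<in> Z \<Longrightarrow> 0 \<le> \<rho> x y"
    and sym: "x \<in> Z \<Longrightarrow> y \<in> Z \<Longrightarrow> \<rho> x y = \<rho> y x"
    and zero_iff: "x \<in> Z \<Longrightarrow> y \<in> Z \<Longrightarrow> \<rho> x y = 0 \<longleftrightarrow> x = y"
    and K_ge_1: "1 \<le> K"
    and triangle: "x \<in> Z \<Longrightarrow> y \<in> Z \<Longrightarrow> z \<in> Z \<Longrightarrow> \<rho> x z \<le> K * max (\<rho> x y) (\<rho> y z)"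

lemma quasi_metric_space_iff: "quasi_metric_space Z \<rho> \<longleftrightarrow> (\<exists>K. quasi_metric Z \<rho> K)"
  unfolding quasi_metric_space_def quasi_metric_def by auto

text \<open>Uniform perfectness seen with \<open>d\<close> sent to infinity: the quotient of the
  distances to \<open>a\<close> and to \<open>d\<close> meets every multiplicative window
  \<open>[l, L * l]\<close>. The product form avoids division at \<open>x = d\<close>.\<close>

definition moebius_perfect :: "'a set \<Rightarrow> ('a \<Rightarrow> 'a \<Rightarrow> real) \<Rightarrow> bool" where
  "moebius_perfect Z \<rho> \<longleftrightarrow>
     (\<exists>L\<ge>1. \<forall>a\<in>Z. \<forall>d\<in>Z. a \<noteq> d \<longrightarrow>
        (\<forall>l>0. \<exists>x\<in>Z. l * \<rho> d x \<le> \<rho> a x \<and> \<rho> a x \<le> L * l * \<rho> d x))"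

text \<open>The conclusion is demanded for every \<open>M\<close>, because a quasimoebius map
  changes the bound on the cross ratios.\<close>

definition moebius_doubling :: "'a set \<Rightarrow> ('a \<Rightarrow> 'a \<Rightarrow> real) \<Rightarrow> bool" where
  "moebius_doubling Z \<rho> \<longleftrightarrow>
     (\<forall>M. \<exists>N::nat. \<forall>S. finite S \<and> S \<subseteq> Z \<longrightarrow>
        (\<forall>a\<in>S. \<forall>b\<in>S. \<forall>c\<in>S. \<forall>d\<in>S. a \<noteq> b \<longrightarrow> c \<noteq> d \<longrightarrow>
           \<rho> a c * \<rho> b d \<le> M * (\<rho> a b * \<rho> c d)) \<longrightarrow> card S \<le> N)"

context quasi_metric
begin

section \<open>Elementary inequalities in a quasi-metric space\<close>

lemma pos: "x \<in> Z \<Longrightarrow> y \<in> Z \<Longrightarrow> x \<noteq> y \<Longrightarrow> 0 < \<rho> x y"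
  using nonneg zero_iff by (metis order_le_less)

lemma self [simp]: "x \<in> Z \<Longrightarrow> \<rho> x x = 0"
  using zero_iff by blast

lemma triangle_le:
  "\<lbrakk>x \<in> Z; y \<in> Z; z \<in> Z; \<rho> x y \<le> u; \<rho> y z \<le> u\<rbrakk> \<Longrightarrow> \<rho> x z \<le> K * u"
  using triangle[of x y z] K_ge_1 mult_left_mono[of "max (\<rho> x y) (\<rho> y z)" u K]
  by (meson max.boundedI order_trans zero_le_one)

lemma ptolemy:
  assumes "a \<in> Z" "b \<in> Z" "c \<in> Z" "d \<in> Z"
  shows "\<rho> a d * \<rho> b c \<le> K\<^sup>2 * max (\<rho> a c * \<rho> b d) (\<rho> a b * \<rho> c d)"
proof -
  \<comment> \<open>Both factors on the left take a detour through the short side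
    \<open>x z\<close>: \<open>x w\<close> passes through \<open>z\<close>, and \<open>y z\<close>
    passes through \<open>x\<close>.\<close>
  have step: "\<rho> x w * \<rho> y z \<le> K\<^sup>2 * (\<rho> x y * \<rho> z w)"
    if "x \<in> Z" "y \<in> Z" "z \<in> Z" "w \<in> Z" "\<rho> x z \<le> \<rho> x y" "\<rho> x z \<le> \<rho> z w" for x y z w
  proof -
    have "\<rho> x w \<le> K * \<rho> z w" "\<rho> y z \<le> K * \<rho> x y"
      using that sym[of y x] triangle_le[of x z w "\<rho> z w"] triangle_le[of y x z "\<rho> x y"] by auto
    then have "\<rho> x w * \<rho> y z \<le> (K * \<rho> z w) * (K * \<rho> x y)"
      using that nonneg K_ge_1 by (intro mult_mono) auto
    then show ?thesis by (simp add: power2_eq_square mult_ac)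
  qed
  have s: "\<rho> d a = \<rho> a d" "\<rho> d c = \<rho> c d" "\<rho> b a = \<rho> a b" "\<rho> d b = \<rho> b d" "\<rho> c b = \<rho> b c" "\<rho> c a = \<rho> a c"
    using sym assms by blast+
  have *: "K\<^sup>2 * u \<le> K\<^sup>2 * max u v" "K\<^sup>2 * v \<le> K\<^sup>2 * max u v" for u v
    by (auto intro: mult_left_mono)
  consider "\<rho> a c \<le> \<rho> a b" "\<rho> a c \<le> \<rho> c d" | "\<rho> b d \<le> \<rho> a b" "\<rho> b d \<le> \<rho> c d"
    | "\<rho> a b \<le> \<rho> a c" "\<rho> a b \<le> \<rho> b d" | "\<rho> c d \<le> \<rho> a c" "\<rho> c d \<le> \<rho> b d"
    by linarith
  \<comment> \<open>One of the four distances on the right is minimal; bound both factors on the left through it.\<close>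
  then show ?thesis
  proof cases
    case 1
    then show ?thesis using step[of a b c d] *(2) assms order_trans by blast
  next
    case 2
    then have "\<rho> a d * \<rho> b c \<le> K\<^sup>2 * (\<rho> a b * \<rho> c d)"
      using step[of d c b a] assms by (simp add: s mult.commute)
    then show ?thesis using *(2) order_trans by blast
  next
    case 3
    then have "\<rho> a d * \<rho> b c \<le> K\<^sup>2 * (\<rho> a c * \<rho> b d)"
      using step[of a c b d] assms by (simp add: s)
    then show ?thesis using *(1) order_trans by blast
  next
    case 4
    then have "\<rho> a d * \<rho> b c \<le> K\<^sup>2 * (\<rho> a c * \<rho> b d)"
      using step[of d b c a] assms by (simp add: s mult.commute)
    then show ?thesis using *(1) order_trans by blast
  qed
qed

text \<open>Since \<open>K * \<rho> a x < \<rho> d x\<close>, the leg \<open>a x\<close> cannot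
  account for the maximum in the triangle inequality from \<open>d\<close> to \<open>x\<close>
  through \<open>a\<close>, so the leg \<open>d a\<close> does. Conversely, both legs of the way
  from \<open>a\<close> to \<open>d\<close> through \<open>x\<close> are at most
  \<open>\<rho> d x\<close>.\<close>

lemma near_first_point:
  assumes Z: "a \<in> Z" "d \<in> Z" "x \<in> Z" and g: "\<rho> a x \<le> g * \<rho> d x" "g < 1 / K" "0 < \<rho> d x"
  shows "\<rho> d x \<le> K * \<rho> a d" "\<rho> a d \<le> K * \<rho> d x"
proof -
  have K: "K > 0" using K_ge_1 by simp
  have "K * (g * \<rho> d x) < \<rho> d x"
    using g K by (simp add: field_simps)
  then have lt: "K * \<rho> a x < \<rho> d x"
    using g K by (meson mult_left_mono order_le_less_trans less_imp_le)
  have "\<rho> d x \<le> K * max (\<rho> d a) (\<rho> a x)" using triangle Z by blast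
  then show "\<rho> d x \<le> K * \<rho> a d" using lt sym Z by (auto simp: max_def split: if_splits)
  have "\<rho> a x \<le> K * \<rho> a x" using mult_right_mono[of 1 K "\<rho> a x"] K_ge_1 nonneg Z by simp
  then show "\<rho> a d \<le> K * \<rho> d x"
    using lt sym Z by (intro triangle_le[of a x d]) auto
qed

section \<open>Uniform perfectness in terms of ratios of distances\<close>

lemma uniformly_perfect_imp_moebius_perfect:
  assumes "uniformly_perfect Z \<rho>"
  shows "moebius_perfect Z \<rho>"
proof -
  obtain \<tau> where \<tau>: "0 < \<tau>" "\<tau> < 1"
    and up: "\<And>x r. x \<in> Z \<Longrightarrow> r > 0 \<Longrightarrow> Z - qball Z \<rho> x r \<noteq> {} \<Longrightarrow>
      qball Z \<rho> x r - qball Z \<rho> x (\<tau> * r) \<noteq> {}"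
    using assms unfolding uniformly_perfect_def by blast
  have K: "K > 0" using K_ge_1 by simp
  \<comment> \<open>This compares the inner radius \<open>\<tau> * r\<close> for
    \<open>r = l * R / K\<close>, where \<open>R = \<rho> a d\<close>, with \<open>l\<close> times
    the bound \<open>\<rho> d x \<le> K * R\<close>.\<close>
  define c where "c = \<tau> / K\<^sup>2"
  have c: "0 < c" "c \<le> 1"
    using \<tau> K_ge_1 one_le_power[OF K_ge_1, of 2] order.trans[of \<tau> 1 "K\<^sup>2"]
    by (auto simp: c_def divide_simps simp del: one_le_power)
  \<comment> \<open>Values at most 1 are found near \<open>a\<close>, the others near \<open>d\<close> by exchanging \<open>a\<close> and \<open>d\<close>.\<close>
  have small: "\<exists>x\<in>Z. c * l * \<rho> d x \<le> \<rho> a x \<and> \<rho> a x \<le> l * \<rho> d x"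
    if ad: "a \<in> Z" "d \<in> Z" "a \<noteq> d" and l: "0 < l" "l \<le> 1" for a d l
  proof -
    define R where "R = \<rho> a d"
    \<comment> \<open>As \<open>r \<le> R / K\<close>, the ball about \<open>a\<close> misses
      \<open>d\<close>, and each of its points \<open>x\<close> has
      \<open>K * \<rho> a x < R\<close>, which forces \<open>R \<le> K * \<rho> d x\<close>.\<close>
    define r where "r = l * R / K"
    have R: "R > 0" using pos ad R_def by blast
    have r: "r > 0" using R l K r_def by simp
    have "l * R \<le> R * 1" using l R by simp
    then have rK: "r \<le> R / K" using K by (simp add: r_def divide_right_mono)
    have "R / K \<le> R" using R K_ge_1 by (simp add: field_simps)
    then have "d \<notin> qball Z \<rho> a r" using rK by (simp add: qball_def R_def)
    then obtain x where x: "x \<in> Z" "\<rho> a x < r" "\<tau> * r \<le> \<rho> a x"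
      using up[of a r] ad r by (fastforce simp: qball_def)
    have "\<rho> d x \<le> K * R"
      using ad x rK \<open>R / K \<le> R\<close> sym by (intro triangle_le[of d a x]) (auto simp: R_def)
    then have "c * l * \<rho> d x \<le> c * l * (K * R)" using c l by (intro mult_left_mono) auto
    also have "\<dots> = \<tau> * r" using K by (simp add: c_def r_def power2_eq_square field_simps)
    finally have 1: "c * l * \<rho> d x \<le> \<rho> a x" using x by simp
    have "R \<le> K * max (\<rho> a x) (\<rho> x d)" using triangle ad x R_def by blast
    moreover have "K * \<rho> a x < R"
      using order_less_le_trans[OF x(2) rK] K by (simp add: field_simps)
    ultimately have "R \<le> K * \<rho> d x" using sym ad x by (auto simp: max_def split: if_splits)
    then have "r \<le> l * \<rho> d x" using l K by (simp add: r_def field_simps)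
    then show ?thesis using 1 x by force
  qed
  have "\<exists>x\<in>Z. c * l * \<rho> d x \<le> \<rho> a x \<and> \<rho> a x \<le> l / c * \<rho> d x"
    if ad: "a \<in> Z" "d \<in> Z" "a \<noteq> d" and l: "0 < l" for a d l
  proof (cases "l \<le> 1")
    case True
    then obtain x where x: "x \<in> Z" "c * l * \<rho> d x \<le> \<rho> a x" "\<rho> a x \<le> l * \<rho> d x"
      using small ad l by blast
    have "l \<le> l / c" using c l by (simp add: field_simps)
    then have "l * \<rho> d x \<le> l / c * \<rho> d x" using nonneg ad x by (intro mult_right_mono) auto
    then show ?thesis using x by force
  next
    case False
    then obtain x where x: "x \<in> Z" "c * (1/l) * \<rho> a x \<le> \<rho> d x" "\<rho> d x \<le> (1/l) * \<rho> a x"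
      using small[of d a "1/l"] ad l by auto
    have "c * (l * \<rho> d x) \<le> 1 * (l * \<rho> d x)" using nonneg ad x c l by (intro mult_right_mono) auto
    moreover have "l * \<rho> d x \<le> \<rho> a x" using x l by (simp add: field_simps)
    moreover have "\<rho> a x \<le> l / c * \<rho> d x" using x l c by (simp add: field_simps)
    ultimately show ?thesis using x by force
  qed
  note * = this
  \<comment> \<open>The window \<open>[c * l, l / c]\<close> taken at \<open>l / c\<close> instead
    of \<open>l\<close> is \<open>[l, l / c^2]\<close>, whence the constant
    \<open>1 / c^2\<close>.\<close>
  show ?thesis
    unfolding moebius_perfect_def
  proof (intro exI[of _ "1 / c\<^sup>2"] conjI ballI allI impI)
    show "1 \<le> 1 / c\<^sup>2" using c by (simp add: field_simps power_le_one)
    fix a d l assume "a \<in> Z" "d \<in> Z" "a \<noteq> d" "0 < (l::real)"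
    then show "\<exists>x\<in>Z. l * \<rho> d x \<le> \<rho> a x \<and> \<rho> a x \<le> 1 / c\<^sup>2 * l * \<rho> d x"
      using *[of a d "l / c"] c by (simp add: power2_eq_square)
  qed
qed

text \<open>A point \<open>d\<close> outside the ball serves as second pole. For a low window the
  point found is so near \<open>a\<close> that its distance to \<open>d\<close> is comparable to
  \<open>\<rho> a d\<close>; the window for the quotient then becomes one for
  \<open>\<rho> a x\<close> alone.\<close>

lemma moebius_perfect_imp_uniformly_perfect:
  assumes "moebius_perfect Z \<rho>"
  shows "uniformly_perfect Z \<rho>"
proof -
  obtain L where L: "L \<ge> 1"
    and mp: "\<And>a d l. a \<in> Z \<Longrightarrow> d \<in> Z \<Longrightarrow> a \<noteq> d \<Longrightarrow> l > 0 \<Longrightarrow>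
      \<exists>x\<in>Z. l * \<rho> d x \<le> \<rho> a x \<and> \<rho> a x \<le> L * l * \<rho> d x"
    using assms unfolding moebius_perfect_def by blast
  have K: "K > 0" using K_ge_1 by simp
  define \<tau> where "\<tau> = 1 / (2 * K\<^sup>2 * L)"
  have KL: "1 \<le> K\<^sup>2 * L" using L one_le_power[OF K_ge_1, of 2] mult_mono[of 1 "K\<^sup>2" 1 L] by simp
  show ?thesis
    unfolding uniformly_perfect_def
  proof (intro exI[of _ \<tau>] conjI ballI allI impI)
    show "0 < \<tau>" "\<tau> < 1" using KL by (auto simp: \<tau>_def field_simps)
    fix a r assume a: "a \<in> Z" and r: "0 < (r::real)" and ne: "Z - qball Z \<rho> a r \<noteq> {}"
    then obtain d where d: "d \<in> Z" "r \<le> \<rho> a d" by (force simp: qball_def)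
    then have "a \<noteq> d" using r a by auto
    define R where "R = \<rho> a d"
    \<comment> \<open>With \<open>R / K \<le> \<rho> d x \<le> K * R\<close>, the upper end of the
      window gives \<open>\<rho> a x \<le> r / 2\<close> and the lower end
      \<open>l * (R / K) = \<tau> * r\<close>.\<close>
    define l where "l = r / (2 * K * L * R)"
    have R: "R > 0" "r \<le> R" using d r by (auto simp: R_def)
    have l: "l > 0" using r R K L by (simp add: l_def)
    obtain x where x: "x \<in> Z" "l * \<rho> d x \<le> \<rho> a x" "\<rho> a x \<le> L * l * \<rho> d x"
      using mp a d \<open>a \<noteq> d\<close> l by blast
    have "x \<noteq> d" using x a d \<open>a \<noteq> d\<close> pos[of a d] by auto
    then have dx: "\<rho> d x > 0" using pos d x by auto
    have Ll: "L * l = r / (2 * K * R)" using L by (simp add: l_def)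
    have "r < 2 * R" using R by simp
    then have "L * l < 1 / K" unfolding Ll using R K by (simp add: field_simps)
    from near_first_point[OF a d(1) x(1) x(3) this dx]
    have n: "\<rho> d x \<le> K * R" "R \<le> K * \<rho> d x" by (auto simp: R_def)
    have "L * l * \<rho> d x \<le> L * l * (K * R)" using n L l by (intro mult_left_mono) auto
    also have "\<dots> = r / 2" using R K by (simp add: Ll)
    finally have 1: "\<rho> a x < r" using x r by simp
    have "\<tau> * r = l * (R / K)"
      using K L R by (simp add: \<tau>_def l_def power2_eq_square field_simps)
    also have "\<dots> \<le> l * \<rho> d x" using n l K by (intro mult_left_mono) (auto simp: field_simps)
    finally have "\<tau> * r \<le> \<rho> a x" using x by simp
    with 1 show "qball Z \<rho> a r - qball Z \<rho> a (\<tau> * r) \<noteq> {}"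
      using x by (auto simp: qball_def)
  qed
qed

lemma uniformly_perfect_iff: "uniformly_perfect Z \<rho> \<longleftrightarrow> moebius_perfect Z \<rho>"
  using uniformly_perfect_imp_moebius_perfect moebius_perfect_imp_uniformly_perfect by blast

section \<open>Doubling in terms of sets with bounded cross ratios\<close>

lemma doubling_iterate:
  assumes C: "\<And>x r. x \<in> Z \<Longrightarrow> r > 0 \<Longrightarrow> \<exists>F. F \<subseteq> Z \<and> finite F \<and> card F \<le> C \<and>
        qball Z \<rho> x r \<subseteq> (\<Union>y\<in>F. qball Z \<rho> y (r / 2))"
    and x: "x \<in> Z" and r: "r > 0"
  shows "\<exists>F. F \<subseteq> Z \<and> finite F \<and> card F \<le> C ^ m \<and>
        qball Z \<rho> x r \<subseteq> (\<Union>y\<in>F. qball Z \<rho> y (r / 2 ^ m))"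
proof (induction m)
  case 0
  show ?case using x by (intro exI[of _ "{x}"]) auto
next
  case (Suc m)
  then obtain F where F: "F \<subseteq> Z" "finite F" "card F \<le> C ^ m"
    "qball Z \<rho> x r \<subseteq> (\<Union>y\<in>F. qball Z \<rho> y (r / 2 ^ m))" by blast
  have "\<forall>y\<in>F. \<exists>G. G \<subseteq> Z \<and> finite G \<and> card G \<le> C \<and>
      qball Z \<rho> y (r / 2 ^ m) \<subseteq> (\<Union>z\<in>G. qball Z \<rho> z (r / 2 ^ m / 2))"
    using C F r by (intro ballI C) auto
  then obtain G where G: "\<And>y. y \<in> F \<Longrightarrow> G y \<subseteq> Z \<and> finite (G y) \<and> card (G y) \<le> C \<and>
      qball Z \<rho> y (r / 2 ^ m) \<subseteq> (\<Union>z\<in>G y. qball Z \<rho> z (r / 2 ^ m / 2))" by metis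
  have "card (\<Union>(G ` F)) \<le> (\<Sum>y\<in>F. card (G y))" using F card_UN_le by blast
  also have "\<dots> \<le> card F * C" using G by (intro sum_bounded_above[where K = C, simplified]) auto
  also have "\<dots> \<le> C ^ Suc m" using F by (simp add: mult.commute)
  finally have "card (\<Union>(G ` F)) \<le> C ^ Suc m" .
  moreover have "qball Z \<rho> x r \<subseteq> (\<Union>z\<in>\<Union>(G ` F). qball Z \<rho> z (r / 2 ^ Suc m))"
  proof
    fix u assume "u \<in> qball Z \<rho> x r"
    then obtain y where y: "y \<in> F" "u \<in> qball Z \<rho> y (r / 2 ^ m)" using F by blast
    then obtain z where "z \<in> G y" "u \<in> qball Z \<rho> z (r / 2 ^ m / 2)" using G by blast
    then show "u \<in> (\<Union>z\<in>\<Union>(G ` F). qball Z \<rho> z (r / 2 ^ Suc m))"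
      using y by (auto simp: field_simps)
  qed
  moreover have "\<Union>(G ` F) \<subseteq> Z" "finite (\<Union>(G ` F))" using F G by blast+
  ultimately show ?case by blast
qed

text \<open>Such a set lies in one ball about any of its points and is separated at a comparable
  scale. After a fixed number of halvings each covering ball holds at most one of its
  points.\<close>

lemma doubling_card_bound:
  assumes "doubling Z \<rho>" and L: "L \<ge> 1"
  shows "\<exists>N::nat. \<forall>S. finite S \<and> S \<subseteq> Z \<longrightarrow>
    (\<forall>i\<in>S. \<forall>j\<in>S. \<forall>k\<in>S. i \<noteq> j \<longrightarrow> \<rho> i k \<le> L * \<rho> i j) \<longrightarrow> card S \<le> N"
proof -
  obtain C where C: "\<And>x r. x \<in> Z \<Longrightarrow> r > 0 \<Longrightarrow> \<exists>F. F \<subseteq> Z \<and> finite F \<and> card F \<le> C \<and>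
        qball Z \<rho> x r \<subseteq> (\<Union>y\<in>F. qball Z \<rho> y (r / 2))"
    using assms unfolding doubling_def by blast
  have K: "K > 0" using K_ge_1 by simp
  \<comment> \<open>Points in a common ball of radius \<open>r / 2 ^ m\<close>, with
    \<open>r = 2 * L * s\<close>, are at most \<open>K * r / 2 ^ m\<close> apart. This choice puts
    that below the separation \<open>s / L^2\<close>.\<close>
  obtain m where m: "2 * L ^ 3 * K < 2 ^ m"
    using real_arch_pow[of 2 "2 * L ^ 3 * K"] by auto
  show ?thesis
  proof (intro exI[of _ "max 1 (C ^ m)"] allI impI)
    fix S assume S: "finite S \<and> S \<subseteq> Z"
      and LS: "\<forall>i\<in>S. \<forall>j\<in>S. \<forall>k\<in>S. i \<noteq> j \<longrightarrow> \<rho> i k \<le> L * \<rho> i j"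
    show "card S \<le> max 1 (C ^ m)"
    proof (cases "\<exists>p\<in>S. \<exists>q\<in>S. p \<noteq> q")
      case False
      then have "card S \<le> 1" using S by (metis card_le_Suc0_iff_eq One_nat_def)
      then show ?thesis by simp
    next
      case True
      then obtain p q where pq: "p \<in> S" "q \<in> S" "p \<noteq> q" by blast
      define s where "s = \<rho> p q"
      have s: "s > 0" using pos pq S s_def by blast
      \<comment> \<open>Distances with a common endpoint differ by a factor of at most
        \<open>L\<close>. In general \<open>p q\<close> and \<open>i j\<close> have none, and
        \<open>p i\<close> links them at the price of a second factor.\<close>
      have sep: "s \<le> L\<^sup>2 * \<rho> i j" if "i \<in> S" "j \<in> S" "i \<noteq> j" for i j
      proof (cases "i = p")
        case True
        then have "s \<le> L * \<rho> i j" using LS that pq s_def by blast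
        also have "\<dots> \<le> L * (L * \<rho> i j)"
          using L that S nonneg mult_right_mono[of 1 L "\<rho> i j"] by (intro mult_left_mono) auto
        finally show ?thesis by (simp add: power2_eq_square mult_ac)
      next
        case False
        then have "s \<le> L * \<rho> p i" unfolding s_def using LS that pq by metis
        also have "\<rho> p i = \<rho> i p" using sym S pq that by blast
        also have "L * \<rho> i p \<le> L * (L * \<rho> i j)"
          using L LS that pq by (intro mult_left_mono) auto
        finally show ?thesis by (simp add: power2_eq_square mult_ac)
      qed
      define r where "r = 2 * L * s"
      have r: "r > 0" using s L by (simp add: r_def)
      obtain F where F: "F \<subseteq> Z" "finite F" "card F \<le> C ^ m"
        "qball Z \<rho> p r \<subseteq> (\<Union>y\<in>F. qball Z \<rho> y (r / 2 ^ m))"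
        using doubling_iterate[OF C, of p r m] pq S r by blast
      have "\<exists>y\<in>F. \<rho> y i < r / 2 ^ m" if "i \<in> S" for i
      proof -
        have "\<rho> p i \<le> L * s" using LS pq that s_def by blast
        also have "\<dots> < r" using s L by (simp add: r_def)
        finally show ?thesis using F that S by (auto simp: qball_def)
      qed
      then obtain \<phi> where \<phi>: "\<And>i. i \<in> S \<Longrightarrow> \<phi> i \<in> F \<and> \<rho> (\<phi> i) i < r / 2 ^ m" by metis
      have "inj_on \<phi> S"
      proof (rule inj_onI, rule ccontr)
        fix i j assume ij: "i \<in> S" "j \<in> S" "\<phi> i = \<phi> j" "i \<noteq> j"
        have Z: "i \<in> Z" "j \<in> Z" "\<phi> i \<in> Z" using ij S F \<phi> by auto
        have "\<rho> i j \<le> K * (r / 2 ^ m)"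
          using \<phi>[OF ij(1)] \<phi>[OF ij(2)] ij Z sym[of i "\<phi> i"] by (intro triangle_le[of i "\<phi> i" j]) auto
        then have "L\<^sup>2 * \<rho> i j \<le> L\<^sup>2 * (K * (r / 2 ^ m))" by (intro mult_left_mono) auto
        also have "\<dots> = 2 * L ^ 3 * K * s / 2 ^ m"
          by (simp add: r_def power2_eq_square power3_eq_cube)
        also have "\<dots> < s" using m s by (simp add: field_simps)
        finally show False using sep ij by force
      qed
      then have "card S \<le> card F" using \<phi> F by (intro card_inj_on_le[of \<phi>]) auto
      then show ?thesis using F by simp
    qed
  qed
qed

lemma doubling_imp_moebius_doubling:
  assumes "doubling Z \<rho>"
  shows "moebius_doubling Z \<rho>"
  unfolding moebius_doubling_def
proof
  fix M0 :: real
  \<comment> \<open>Raising the bound to at least 1 yields \<open>M * K \<ge> 1\<close>, as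
    \<open>doubling_card_bound\<close> requires.\<close>
  define M where "M = max 1 M0"
  have K: "K > 0" using K_ge_1 by simp
  have MK: "M * K \<ge> 1" using K_ge_1 mult_mono[of 1 M 1 K] by (auto simp: M_def)
  from doubling_card_bound[OF assms MK] obtain N where N: "\<forall>S. finite S \<and> S \<subseteq> Z \<longrightarrow>
    (\<forall>i\<in>S. \<forall>j\<in>S. \<forall>k\<in>S. i \<noteq> j \<longrightarrow> \<rho> i k \<le> M * K * \<rho> i j) \<longrightarrow> card S \<le> N" ..
  show "\<exists>N::nat. \<forall>S. finite S \<and> S \<subseteq> Z \<longrightarrow>
        (\<forall>a\<in>S. \<forall>b\<in>S. \<forall>c\<in>S. \<forall>d\<in>S. a \<noteq> b \<longrightarrow> c \<noteq> d \<longrightarrow>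
           \<rho> a c * \<rho> b d \<le> M0 * (\<rho> a b * \<rho> c d)) \<longrightarrow> card S \<le> N"
  proof (intro exI[of _ "max 1 (2 * N)"] allI impI)
    fix S assume S: "finite S \<and> S \<subseteq> Z"
      and cr0: "\<forall>a\<in>S. \<forall>b\<in>S. \<forall>c\<in>S. \<forall>d\<in>S. a \<noteq> b \<longrightarrow> c \<noteq> d \<longrightarrow>
           \<rho> a c * \<rho> b d \<le> M0 * (\<rho> a b * \<rho> c d)"
    have cr: "\<rho> a c * \<rho> b d \<le> M * (\<rho> a b * \<rho> c d)"
      if "a \<in> S" "b \<in> S" "c \<in> S" "d \<in> S" "a \<noteq> b" "c \<noteq> d" for a b c d
    proof -
      have "0 \<le> \<rho> a b * \<rho> c d"
        using that S by (intro mult_nonneg_nonneg nonneg) auto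
      then have "M0 * (\<rho> a b * \<rho> c d) \<le> M * (\<rho> a b * \<rho> c d)"
        by (intro mult_right_mono) (auto simp: M_def)
      moreover have "\<rho> a c * \<rho> b d \<le> M0 * (\<rho> a b * \<rho> c d)" using cr0 that by blast
      ultimately show ?thesis by linarith
    qed
    show "card S \<le> max 1 (2 * N)"
    proof (cases "\<exists>p\<in>S. \<exists>q\<in>S. p \<noteq> q")
      case False
      then have "card S \<le> 1" using S by (metis card_le_Suc0_iff_eq One_nat_def)
      then show ?thesis by simp
    next
      case True
      \<comment> \<open>Take a farthest pair \<open>p\<close>, \<open>q\<close>. Points far from \<open>q\<close> have pairwise comparable distances, as the
        cross ratios with \<open>q\<close> as fourth point show; likewise for \<open>p\<close>, and each point is far from one.\<close>
      define D where "D = Max ((\<lambda>(x, y). \<rho> x y) ` (S \<times> S))"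
      have "D \<in> (\<lambda>(x, y). \<rho> x y) ` (S \<times> S)"
        unfolding D_def using S True by (intro Max_in) auto
      then obtain p q where pq: "p \<in> S" "q \<in> S" "\<rho> p q = D" by auto
      have D: "\<rho> x y \<le> D" if "x \<in> S" "y \<in> S" for x y
        unfolding D_def using S that by (intro Max_ge) auto
      have Dpos: "D > 0" using True pos S D by (metis order_less_le_trans subsetD)
      have bound: "card {i \<in> S. D \<le> K * \<rho> i q} \<le> N" if q: "q \<in> S" for q
      proof (rule N[rule_format])
        fix i j k assume ijk: "i \<in> {i \<in> S. D \<le> K * \<rho> i q}" "j \<in> {i \<in> S. D \<le> K * \<rho> i q}"
          "k \<in> {i \<in> S. D \<le> K * \<rho> i q}" "i \<noteq> j"
        have "k \<noteq> q" using ijk Dpos q S by auto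
        then have "\<rho> i k * \<rho> j q \<le> M * (\<rho> i j * \<rho> k q)" using cr ijk q by blast
        \<comment> \<open>\<open>D\<close> is the largest distance and \<open>j\<close> is far from
          \<open>q\<close>, so \<open>\<rho> k q \<le> D \<le> K * \<rho> j q\<close>; afterwards
          \<open>\<rho> j q\<close> cancels.\<close>
        also have "\<dots> \<le> M * (\<rho> i j * (K * \<rho> j q))"
          using ijk S q D[of k q] by (intro mult_left_mono nonneg) (auto simp: M_def)
        finally have "\<rho> i k * \<rho> j q \<le> (M * K * \<rho> i j) * \<rho> j q" by (simp add: mult_ac)
        moreover have "\<rho> j q > 0" 
          using ijk Dpos K zero_less_mult_pos[of K "\<rho> j q"] by force
        ultimately show "\<rho> i k \<le> M * K * \<rho> i j" by simp
      qed (use S in auto)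
      have "S \<subseteq> {i \<in> S. D \<le> K * \<rho> i p} \<union> {i \<in> S. D \<le> K * \<rho> i q}"
      proof
        fix i assume i: "i \<in> S"
        then have "D \<le> K * max (\<rho> p i) (\<rho> i q)" using triangle[of p i q] pq S by auto
        moreover have "\<rho> p i = \<rho> i p" using sym S i pq by blast
        ultimately show "i \<in> {i \<in> S. D \<le> K * \<rho> i p} \<union> {i \<in> S. D \<le> K * \<rho> i q}"
          using i by (auto simp: max_def split: if_splits)
      qed
      then have "card S \<le> card ({i \<in> S. D \<le> K * \<rho> i p} \<union> {i \<in> S. D \<le> K * \<rho> i q})"
        using S by (intro card_mono) auto
      also have "\<dots> \<le> N + N" using bound[of p] bound[of q] pq card_Un_le by (meson add_mono order_trans)
      finally show ?thesis by simp
    qed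
  qed
qed

text \<open>In an \<open>r / 2\<close>-separated subset of a ball of radius \<open>r\<close>,
  distinct points have distances between \<open>r / 2\<close> and \<open>K * r\<close>, so the cross
  ratios are at most \<open>4 * K^2\<close> and the cardinality is bounded. A largest such subset
  supplies the centres of the covering balls.\<close>

lemma moebius_doubling_imp_doubling:
  assumes "moebius_doubling Z \<rho>"
  shows "doubling Z \<rho>"
proof -
  have K: "K > 0" using K_ge_1 by simp
  from assms[unfolded moebius_doubling_def, THEN spec, of "4 * K\<^sup>2"]
  obtain N where N: "\<forall>S. finite S \<and> S \<subseteq> Z \<longrightarrow>
        (\<forall>a\<in>S. \<forall>b\<in>S. \<forall>c\<in>S. \<forall>d\<in>S. a \<noteq> b \<longrightarrow> c \<noteq> d \<longrightarrow>
           \<rho> a c * \<rho> b d \<le> 4 * K\<^sup>2 * (\<rho> a b * \<rho> c d)) \<longrightarrow> card S \<le> N" ..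
  show ?thesis
    unfolding doubling_def
  proof (intro exI[of _ N] ballI allI impI)
    fix x r assume x: "x \<in> Z" and r: "0 < (r::real)"
    define sep where "sep S \<longleftrightarrow> finite S \<and> S \<subseteq> qball Z \<rho> x r \<and>
      (\<forall>a\<in>S. \<forall>b\<in>S. a \<noteq> b \<longrightarrow> r / 2 \<le> \<rho> a b)" for S
    have sepN: "card S \<le> N" if S: "sep S" for S
    proof (rule N[rule_format])
      show SZ: "finite S \<and> S \<subseteq> Z" using S by (auto simp: sep_def qball_def)
      fix a b c d assume abcd: "a \<in> S" "b \<in> S" "c \<in> S" "d \<in> S" "a \<noteq> b" "c \<noteq> d"
      have close: "\<rho> u v \<le> K * r" if "u \<in> S" "v \<in> S" for u v
        using that S x sym[of u x] by (intro triangle_le[of u x v]) (auto simp: sep_def qball_def)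
      have "\<rho> a c * \<rho> b d \<le> (K * r) * (K * r)"
        using abcd close K r SZ by (intro mult_mono nonneg) auto
      also have "\<dots> = (4 * K\<^sup>2) * (r / 2 * (r / 2))" by (simp add: power2_eq_square)
      also have "\<dots> \<le> (4 * K\<^sup>2) * (\<rho> a b * \<rho> c d)"
        using abcd S r by (intro mult_left_mono mult_mono) (auto simp: sep_def qball_def intro!: nonneg)
      finally show "\<rho> a c * \<rho> b d \<le> (4 * K\<^sup>2) * (\<rho> a b * \<rho> c d)" .
    qed
    have "sep {}" by (simp add: sep_def)
    \<comment> \<open>The uniform bound \<open>N\<close> on the cardinalities makes a separated set
      of greatest size exist.\<close>
    then obtain S where S: "sep S" and mx: "\<And>T. sep T \<Longrightarrow> card T \<le> card S"
      using ex_has_greatest_nat[of sep "{}" card "Suc N"] sepN by (auto simp: less_Suc_eq_le)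
    have "y \<in> (\<Union>z\<in>S. qball Z \<rho> z (r / 2))" if y: "y \<in> qball Z \<rho> x r" for y
    proof (rule ccontr)
      assume "y \<notin> (\<Union>z\<in>S. qball Z \<rho> z (r / 2))"
      then have far: "\<And>z. z \<in> S \<Longrightarrow> r / 2 \<le> \<rho> z y" using y by (force simp: qball_def)
      have "y \<notin> S" using far[of y] r y by (auto simp: qball_def)
      have "sep (insert y S)"
        using S y far sym by (auto simp: sep_def qball_def subset_iff)
      then have "card (insert y S) \<le> card S" using mx by blast
      then show False using \<open>y \<notin> S\<close> S by (simp add: sep_def)
    qed
    then show "\<exists>F. F \<subseteq> Z \<and> finite F \<and> card F \<le> N \<and> qball Z \<rho> x r \<subseteq> (\<Union>y\<in>F. qball Z \<rho> y (r / 2))"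
      using S sepN by (intro exI[of _ S]) (auto simp: sep_def qball_def)
  qed
qed

lemma doubling_iff: "doubling Z \<rho> \<longleftrightarrow> moebius_doubling Z \<rho>"
  using doubling_imp_moebius_doubling moebius_doubling_imp_doubling by blast

end

section \<open>Control of cross ratios\<close>

text \<open>
  With \<open>d\<close> sent to infinity, \<open>inverted\<close> is a quasi-metric by the Ptolemy inequality, and \<open>ratio\<close> is
  the inverted distance to \<open>a\<close>.
\<close>

definition ratio :: "('a \<Rightarrow> 'a \<Rightarrow> real) \<Rightarrow> 'a \<Rightarrow> 'a \<Rightarrow> 'a \<Rightarrow> real" where
  "ratio \<rho> a d x = \<rho> a x / \<rho> d x"

definition inverted :: "('a \<Rightarrow> 'a \<Rightarrow> real) \<Rightarrow> 'a \<Rightarrow> 'a \<Rightarrow> 'a \<Rightarrow> 'a \<Rightarrow> real" where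
  "inverted \<rho> a d x y = \<rho> x y * \<rho> a d / (\<rho> d x * \<rho> d y)"

context quasi_metric
begin

lemma ratio_pos: "\<lbrakk>a \<in> Z; d \<in> Z; x \<in> Z; x \<noteq> a; x \<noteq> d\<rbrakk> \<Longrightarrow> 0 < ratio \<rho> a d x"
  using pos[of a x] pos[of d x] by (simp add: ratio_def)

lemma ratio_nonneg: "\<lbrakk>a \<in> Z; d \<in> Z; x \<in> Z\<rbrakk> \<Longrightarrow> 0 \<le> ratio \<rho> a d x"
  using nonneg by (simp add: ratio_def)

lemma inverted_sym: "\<lbrakk>x \<in> Z; y \<in> Z\<rbrakk> \<Longrightarrow> inverted \<rho> a d x y = inverted \<rho> a d y x"
  using sym[of x y] by (simp add: inverted_def mult.commute)

text \<open>For \<open>l > 0\<close> and \<open>a \<noteq> d\<close> the product inequalities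
  already exclude \<open>x = a\<close> and \<open>x = d\<close>, so dividing by
  \<open>\<rho> d x\<close> is harmless.\<close>

lemma moebius_perfect_iff_ratio:
  "moebius_perfect Z \<rho> \<longleftrightarrow>
     (\<exists>L\<ge>1. \<forall>a\<in>Z. \<forall>d\<in>Z. a \<noteq> d \<longrightarrow>
        (\<forall>l>0. \<exists>x\<in>Z. x \<noteq> a \<and> x \<noteq> d \<and> l \<le> ratio \<rho> a d x \<and> ratio \<rho> a d x \<le> L * l))"
proof -
  have "x \<in> Z \<and> l * \<rho> d x \<le> \<rho> a x \<and> \<rho> a x \<le> L * l * \<rho> d x \<longleftrightarrow>
    x \<in> Z \<and> x \<noteq> a \<and> x \<noteq> d \<and> l \<le> ratio \<rho> a d x \<and> ratio \<rho> a d x \<le> L * l"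
    if "a \<in> Z" "d \<in> Z" "a \<noteq> d" "0 < l" for a d x l L
  proof (cases "x \<in> Z \<and> x \<noteq> a \<and> x \<noteq> d")
    case True
    then have "\<rho> d x > 0" using that pos by auto
    then show ?thesis using True by (simp add: ratio_def pos_le_divide_eq pos_divide_le_eq)
  next
    case False
    have "0 < \<rho> a d" "0 < l * \<rho> d a" using that pos by auto
    then show ?thesis using False that by auto
  qed
  then show ?thesis unfolding moebius_perfect_def Bex_def by (simp cong: conj_cong)
qed

text \<open>The Ptolemy inequality divided by \<open>\<rho> d x * \<rho> d y\<close> is the triangle
  inequality for the inverted distances among \<open>a\<close>, \<open>x\<close>, \<open>y\<close>;
  here for the side \<open>x y\<close>.\<close>

lemma inverted_le:
  assumes "a \<in> Z" "d \<in> Z" "x \<in> Z" "y \<in> Z" "x \<noteq> d" "y \<noteq> d"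
  shows "inverted \<rho> a d x y \<le> K\<^sup>2 * max (ratio \<rho> a d x) (ratio \<rho> a d y)"
proof -
  have p: "0 < \<rho> d x" "0 < \<rho> d y" using pos assms by auto
  have s: "\<rho> y d = \<rho> d y" "\<rho> x d = \<rho> d x" using sym assms by auto
  have "\<rho> a d * \<rho> x y \<le> K\<^sup>2 * max (\<rho> a y * \<rho> d x) (\<rho> a x * \<rho> d y)"
    using ptolemy[of a x y d] assms s by simp
  then have "\<rho> a d * \<rho> x y / (\<rho> d x * \<rho> d y)
      \<le> K\<^sup>2 * max (\<rho> a y * \<rho> d x) (\<rho> a x * \<rho> d y) / (\<rho> d x * \<rho> d y)"
    using p by (intro divide_right_mono) auto
  also have "\<dots> = K\<^sup>2 * max (ratio \<rho> a d x) (ratio \<rho> a d y)"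
    using p by (simp add: ratio_def max_divide_distrib_right[symmetric] flip: times_divide_eq_right)
      (simp add: max_divide_distrib_right max.commute)
  finally show ?thesis by (simp add: inverted_def mult.commute)
qed

text \<open>The same triangle inequality for the side \<open>a y\<close>, used to bound
  \<open>inverted\<close> from below.\<close>

lemma ratio_le_inverted:
  assumes "a \<in> Z" "d \<in> Z" "x \<in> Z" "y \<in> Z" "x \<noteq> d" "y \<noteq> d"
  shows "ratio \<rho> a d y \<le> K\<^sup>2 * max (inverted \<rho> a d x y) (ratio \<rho> a d x)"
proof -
  have p: "0 < \<rho> d x" "0 < \<rho> d y" using pos assms by auto
  have s: "\<rho> y d = \<rho> d y" "\<rho> y x = \<rho> x y" using sym assms by auto
  have "\<rho> a y * \<rho> d x \<le> K\<^sup>2 * max (\<rho> x y * \<rho> a d) (\<rho> a x * \<rho> d y)"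
    using ptolemy[of a d x y] assms s by (simp add: max.commute mult.commute)
  then have "\<rho> a y * \<rho> d x / (\<rho> d x * \<rho> d y)
      \<le> K\<^sup>2 * max (\<rho> x y * \<rho> a d) (\<rho> a x * \<rho> d y) / (\<rho> d x * \<rho> d y)"
    using p by (intro divide_right_mono) auto
  also have "\<dots> = K\<^sup>2 * max (inverted \<rho> a d x y) (ratio \<rho> a d x)"
    using p by (simp add: ratio_def inverted_def flip: times_divide_eq_right)
      (simp add: max_divide_distrib_right)
  finally show ?thesis using p by (simp add: ratio_def)
qed

end

text \<open>Both quasi-metrics live on one set, since that of the target is pulled back. A single
  pair \<open>s\<close>, \<open>t\<close> expresses the weak condition; a family with
  \<open>t = \<theta> s\<close> expresses the quasimoebius condition.\<close>

definition cross_control ::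
  "'a set \<Rightarrow> ('a \<Rightarrow> 'a \<Rightarrow> real) \<Rightarrow> ('a \<Rightarrow> 'a \<Rightarrow> real) \<Rightarrow> real \<Rightarrow> real \<Rightarrow> bool" where
  "cross_control Z \<rho>1 \<rho>2 s t \<longleftrightarrow>
     (\<forall>a\<in>Z. \<forall>b\<in>Z. \<forall>c\<in>Z. \<forall>d\<in>Z. a \<noteq> b \<longrightarrow> c \<noteq> d \<longrightarrow>
        \<rho>1 a c * \<rho>1 b d \<le> s * (\<rho>1 a b * \<rho>1 c d) \<longrightarrow>
        \<rho>2 a c * \<rho>2 b d \<le> t * (\<rho>2 a b * \<rho>2 c d))"

section \<open>Comparing the cross ratios of two quasi-metrics on one set\<close>

locale quasi_metric_pair = A: quasi_metric Z \<rho>1 K1 + B: quasi_metric Z \<rho>2 K2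
  for Z :: "'a set" and \<rho>1 K1 \<rho>2 K2
begin

lemma flip: "quasi_metric_pair Z \<rho>2 K2 \<rho>1 K1" ..

lemma cross_controlD:
  "\<lbrakk>cross_control Z \<rho>1 \<rho>2 s t; a \<in> Z; b \<in> Z; c \<in> Z; d \<in> Z; a \<noteq> b; c \<noteq> d;
    \<rho>1 a c * \<rho>1 b d \<le> s * (\<rho>1 a b * \<rho>1 c d)\<rbrakk>
   \<Longrightarrow> \<rho>2 a c * \<rho>2 b d \<le> t * (\<rho>2 a b * \<rho>2 c d)"
  unfolding cross_control_def by blast

lemma control_mono:
  assumes "cross_control Z \<rho>1 \<rho>2 s t" "t \<le> t'"
  shows "cross_control Z \<rho>1 \<rho>2 s t'"
  unfolding cross_control_def
proof (intro ballI impI)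
  fix a b c d assume *: "a \<in> Z" "b \<in> Z" "c \<in> Z" "d \<in> Z" "a \<noteq> b" "c \<noteq> d"
    "\<rho>1 a c * \<rho>1 b d \<le> s * (\<rho>1 a b * \<rho>1 c d)"
  then have "\<rho>2 a c * \<rho>2 b d \<le> t * (\<rho>2 a b * \<rho>2 c d)" using cross_controlD assms by blast
  also have "\<dots> \<le> t' * (\<rho>2 a b * \<rho>2 c d)"
    using assms * by (intro mult_right_mono mult_nonneg_nonneg B.nonneg)
  finally show "\<rho>2 a c * \<rho>2 b d \<le> t' * (\<rho>2 a b * \<rho>2 c d)" .
qed

text \<open>Exchanging \<open>b\<close> and \<open>c\<close> inverts a cross ratio. If the one for
  \<open>\<rho>1\<close> exceeded \<open>1 / s\<close>, its inverse would be below \<open>s\<close>,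
  so the one for \<open>\<rho>2\<close> would be at least \<open>1 / t\<close>; the factor 2 makes
  this a contradiction.\<close>

lemma control_inverse:
  assumes ctl: "cross_control Z \<rho>1 \<rho>2 s t" and st: "0 < s" "0 < t"
  shows "cross_control Z \<rho>2 \<rho>1 (1 / (2 * t)) (1 / s)"
  unfolding cross_control_def
proof (intro ballI impI)
  fix a b c d assume Z: "a \<in> Z" "b \<in> Z" "c \<in> Z" "d \<in> Z" and ne: "a \<noteq> b" "c \<noteq> d"
    and le: "\<rho>2 a c * \<rho>2 b d \<le> 1 / (2 * t) * (\<rho>2 a b * \<rho>2 c d)"
  have P1: "0 < \<rho>1 a b * \<rho>1 c d" and P2: "0 < \<rho>2 a b * \<rho>2 c d"
    using Z ne A.pos B.pos by auto
  show "\<rho>1 a c * \<rho>1 b d \<le> 1 / s * (\<rho>1 a b * \<rho>1 c d)"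
  proof (cases "a = c \<or> b = d")
    case True
    then have eq: "\<rho>1 a c * \<rho>1 b d = 0" using Z by auto
    show ?thesis unfolding eq using P1 st by simp
  next
    case False
    show ?thesis
    proof (rule ccontr)
      assume "\<not> ?thesis"
      then have "\<rho>1 a b * \<rho>1 c d \<le> s * (\<rho>1 a c * \<rho>1 b d)" using st by (simp add: field_simps)
      then have "\<rho>2 a b * \<rho>2 c d \<le> t * (\<rho>2 a c * \<rho>2 b d)"
        using cross_controlD[OF ctl, of a c b d] Z False by blast
      moreover have "t * (\<rho>2 a c * \<rho>2 b d) \<le> (\<rho>2 a b * \<rho>2 c d) / 2"
        using mult_left_mono[OF le, of t] st by (simp add: field_simps)
      ultimately show False using P2 by linarith
    qed
  qed
qed

text \<open>The quotient of the ratios at \<open>x\<close> and \<open>y\<close> is the cross ratio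
  of \<open>a, y, x, d\<close>.\<close>

lemma ratio_control:
  assumes ctl: "cross_control Z \<rho>1 \<rho>2 s t"
    and Z: "a \<in> Z" "d \<in> Z" "x \<in> Z" "y \<in> Z" and ne: "x \<noteq> d" "y \<noteq> a" "y \<noteq> d"
    and le: "ratio \<rho>1 a d x \<le> s * ratio \<rho>1 a d y"
  shows "ratio \<rho>2 a d x \<le> t * ratio \<rho>2 a d y"
proof -
  have p: "0 < \<rho>1 d x" "0 < \<rho>1 d y" "0 < \<rho>2 d x" "0 < \<rho>2 d y" using Z ne A.pos B.pos by auto
  have s: "\<rho>1 x d = \<rho>1 d x" "\<rho>1 y d = \<rho>1 d y" "\<rho>2 x d = \<rho>2 d x" "\<rho>2 y d = \<rho>2 d y"
    using Z A.sym B.sym by auto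
  have "\<rho>1 a x * \<rho>1 y d \<le> s * (\<rho>1 a y * \<rho>1 x d)"
    using le p by (simp add: ratio_def s field_simps)
  then have "\<rho>2 a x * \<rho>2 y d \<le> t * (\<rho>2 a y * \<rho>2 x d)"
    using cross_controlD[OF ctl, of a y x d] Z ne by blast
  then show ?thesis using p by (simp add: ratio_def s field_simps)
qed

text \<open>The inverted distance of \<open>x\<close> and \<open>y\<close> divided by the ratio at
  \<open>x\<close> is the cross ratio of \<open>x, a, y, d\<close>.\<close>

lemma inverted_control:
  assumes ctl: "cross_control Z \<rho>1 \<rho>2 s t"
    and Z: "a \<in> Z" "d \<in> Z" "x \<in> Z" "y \<in> Z" and ne: "x \<noteq> d" "x \<noteq> a" "y \<noteq> d"
    and le: "inverted \<rho>1 a d x y \<le> s * ratio \<rho>1 a d x"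
  shows "inverted \<rho>2 a d x y \<le> t * ratio \<rho>2 a d x"
proof -
  have p: "0 < \<rho>1 d x" "0 < \<rho>1 d y" "0 < \<rho>2 d x" "0 < \<rho>2 d y" using Z ne A.pos B.pos by auto
  have s: "\<rho>1 x a = \<rho>1 a x" "\<rho>1 y d = \<rho>1 d y" "\<rho>2 x a = \<rho>2 a x" "\<rho>2 y d = \<rho>2 d y"
    using Z A.sym B.sym by auto
  have "\<rho>1 x y * \<rho>1 a d \<le> s * (\<rho>1 x a * \<rho>1 y d)"
    using le p by (simp add: ratio_def inverted_def s field_simps)
  then have "\<rho>2 x y * \<rho>2 a d \<le> t * (\<rho>2 x a * \<rho>2 y d)"
    using cross_controlD[OF ctl, of x a y d] Z ne by blast
  then show ?thesis using p by (simp add: ratio_def inverted_def s field_simps)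
qed

text \<open>Coincidences among the points make the cross ratio 0 or 1 for both quasi-metrics at
  once, so only distinct points need an argument. The value 1 is the reason for the second
  assumption on \<open>t\<close>.\<close>

lemma cross_controlI:
  assumes t: "0 \<le> t" "1 \<le> s \<Longrightarrow> 1 \<le> t"
    and ratio: "\<And>a b c d. \<lbrakk>a \<in> Z; b \<in> Z; c \<in> Z; d \<in> Z; distinct [a, b, c, d];
      ratio \<rho>1 a d c \<le> s * ratio \<rho>1 a d b\<rbrakk> \<Longrightarrow> ratio \<rho>2 a d c \<le> t * ratio \<rho>2 a d b"
  shows "cross_control Z \<rho>1 \<rho>2 s t"
  unfolding cross_control_def
proof (intro ballI impI)
  fix a b c d assume Z: "a \<in> Z" "b \<in> Z" "c \<in> Z" "d \<in> Z" and ne: "a \<noteq> b" "c \<noteq> d"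
    and le: "\<rho>1 a c * \<rho>1 b d \<le> s * (\<rho>1 a b * \<rho>1 c d)"
  have P1: "0 < \<rho>1 a b * \<rho>1 c d" and P2: "0 < \<rho>2 a b * \<rho>2 c d"
    using Z ne A.pos B.pos by auto
  consider "a = c \<or> b = d" | "a = d \<or> b = c" | "distinct [a, b, c, d]" using ne by auto
  then show "\<rho>2 a c * \<rho>2 b d \<le> t * (\<rho>2 a b * \<rho>2 c d)"
  proof cases
    case 1
    then have eq: "\<rho>2 a c * \<rho>2 b d = 0" using Z by auto
    show ?thesis unfolding eq using P2 t by simp
  next
    case 2
    then have eq: "\<rho>1 a c * \<rho>1 b d = \<rho>1 a b * \<rho>1 c d" "\<rho>2 a c * \<rho>2 b d = \<rho>2 a b * \<rho>2 c d"
      using Z A.sym B.sym by (auto simp: mult.commute)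
    then have "1 \<le> s" using le P1 mult_right_le_imp_le[of 1 "\<rho>1 a b * \<rho>1 c d" s] by linarith
    then show ?thesis using t eq P2 mult_right_mono[of 1 t "\<rho>2 a b * \<rho>2 c d"] by linarith
  next
    case 3
    have p: "0 < \<rho>1 d b" "0 < \<rho>1 d c" "0 < \<rho>2 d b" "0 < \<rho>2 d c" using Z 3 A.pos B.pos by auto
    have s: "\<rho>1 b d = \<rho>1 d b" "\<rho>1 c d = \<rho>1 d c" "\<rho>2 b d = \<rho>2 d b" "\<rho>2 c d = \<rho>2 d c"
      using Z A.sym B.sym by auto
    have "ratio \<rho>1 a d c \<le> s * ratio \<rho>1 a d b" using le p by (simp add: ratio_def s field_simps)
    from ratio[OF Z 3 this] show ?thesis using p by (simp add: ratio_def s field_simps)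
  qed
qed

section \<open>From one bound to all bounds, and to power bounds\<close>

text \<open>Perfectness of \<open>\<rho>2\<close> builds a long geometric chain, and doubling of
  \<open>\<rho>1\<close> limits its length. With the two quasi-metrics exchanged, the lemma also
  serves the inverse map.\<close>

lemma control_any_bound:
  assumes ctl: "cross_control Z \<rho>1 \<rho>2 h H" and h: "0 < h" and H: "1 \<le> H"
    and perf: "moebius_perfect Z \<rho>2" and doub: "moebius_doubling Z \<rho>1" and t: "1 \<le> t"
  shows "\<exists>T\<ge>1. cross_control Z \<rho>1 \<rho>2 t T"
proof -
  obtain L where L: "L \<ge> 1" and mp: "\<And>a d l. a \<in> Z \<Longrightarrow> d \<in> Z \<Longrightarrow> a \<noteq> d \<Longrightarrow> 0 < l \<Longrightarrow>
      \<exists>x\<in>Z. x \<noteq> a \<and> x \<noteq> d \<and> l \<le> ratio \<rho>2 a d x \<and> ratio \<rho>2 a d x \<le> L * l"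
    using perf[unfolded B.moebius_perfect_iff_ratio] by auto
  \<comment> \<open>The square of the quotient of the bounds found below for inverted distances
    along the chain: at most \<open>K1^2 * t * g1 b / h\<close>, at least
    \<open>h^2 * g1 b\<close>.\<close>
  define M where "M = (K1\<^sup>2 * t / h ^ 3)\<^sup>2"
  from doub[unfolded moebius_doubling_def, THEN spec, of M]
  obtain N where N: "\<forall>S. finite S \<and> S \<subseteq> Z \<longrightarrow>
        (\<forall>a\<in>S. \<forall>b\<in>S. \<forall>c\<in>S. \<forall>d\<in>S. a \<noteq> b \<longrightarrow> c \<noteq> d \<longrightarrow>
           \<rho>1 a c * \<rho>1 b d \<le> M * (\<rho>1 a b * \<rho>1 c d)) \<longrightarrow> card S \<le> N" ..
  have K1: "1 \<le> K1\<^sup>2" and K2: "1 \<le> K2\<^sup>2" using A.K_ge_1 B.K_ge_1 by auto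
  \<comment> \<open>One growth step must beat the window width \<open>L\<close>, the Ptolemy
    constant \<open>K2^2\<close> and the control bound \<open>H\<close>; the factor 2 keeps the
    comparison strict.\<close>
  define B where "B = 2 * H * K2\<^sup>2 * L"
  have HK: "H \<le> H * K2\<^sup>2" using mult_left_mono[OF K2, of H] H by simp
  have HKL: "H * K2\<^sup>2 \<le> H * K2\<^sup>2 * L" using mult_left_mono[OF L, of "H * K2\<^sup>2"] H HK by simp
  have "B = 2 * (H * K2\<^sup>2 * L)" by (simp add: B_def)
  then have B: "H < B" "1 \<le> B" using H HK HKL by linarith+
  \<comment> \<open>If \<open>g2 c\<close> exceeds \<open>T * g2 b\<close>, it still exceeds
    \<open>H\<close> times the value at each of the \<open>N + 1\<close> points
    \<open>e 0, ..., e N\<close>.\<close>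
  define T where "T = H * L * B ^ Suc N"
  have T: "1 \<le> T" unfolding T_def using mult_mono[of 1 "H * L" 1 "B ^ Suc N"] mult_mono[of 1 H 1 L] H L
    one_le_power[OF B(2), of "Suc N"] by auto
  have "ratio \<rho>2 a d c \<le> T * ratio \<rho>2 a d b"
    if Z: "a \<in> Z" "b \<in> Z" "c \<in> Z" "d \<in> Z" and ne: "distinct [a, b, c, d]"
      and le: "ratio \<rho>1 a d c \<le> t * ratio \<rho>1 a d b" for a b c d
  proof (rule ccontr)
    define g1 where "g1 = ratio \<rho>1 a d"
    define g2 where "g2 = ratio \<rho>2 a d"
    assume "\<not> ratio \<rho>2 a d c \<le> T * ratio \<rho>2 a d b"
    then have gt: "T * g2 b < g2 c" by (simp add: g2_def)
    have g: "0 < g1 b" "0 < g2 b" using Z ne A.ratio_pos B.ratio_pos by (auto simp: g1_def g2_def)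
    have "\<exists>x\<in>Z. x \<noteq> a \<and> x \<noteq> d \<and> B ^ Suc i * g2 b \<le> g2 x \<and> g2 x \<le> L * (B ^ Suc i * g2 b)" for i
      unfolding g2_def using mp[of a d "B ^ Suc i * ratio \<rho>2 a d b"] Z ne B g by (simp add: g2_def)
    then obtain e where eZ: "\<And>i. e i \<in> Z" and ea: "\<And>i. e i \<noteq> a" and ed: "\<And>i. e i \<noteq> d"
      and elo: "\<And>i. B ^ Suc i * g2 b \<le> g2 (e i)" and ehi: "\<And>i. g2 (e i) \<le> L * (B ^ Suc i * g2 b)"
      by metis
    have e2: "0 < g2 (e i)" for i using eZ ea ed Z B.ratio_pos by (simp add: g2_def)
    \<comment> \<open>Otherwise the weak condition would give
      \<open>g2 (e i) \<le> H * g2 b\<close>. The exponent \<open>Suc i\<close> puts even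
      \<open>e 0\<close> above this, because \<open>H < B\<close>.\<close>
    have lo1: "h * g1 b < g1 (e i)" for i
    proof (rule ccontr)
      assume "\<not> h * g1 b < g1 (e i)"
      then have "g2 (e i) \<le> H * g2 b"
        using ratio_control[OF ctl Z(1,4) eZ[of i] Z(2)] ed ne by (auto simp: g1_def g2_def)
      moreover have "B * 1 \<le> B * B ^ i" using B by (intro mult_left_mono one_le_power) auto
      ultimately have "B ^ Suc i * g2 b \<le> H * g2 b" "H < B ^ Suc i"
        using elo[of i] B(1) unfolding power_Suc by linarith+
      then show False using g mult_right_le_imp_le[of "B ^ Suc i" "g2 b" H] by linarith
    qed
    \<comment> \<open>Otherwise \<open>g1 c \<le> h * g1 (e i)\<close>, and the weak condition would
      bring \<open>g2 c\<close> down to \<open>T * g2 b\<close>.\<close>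
    have hi1: "g1 (e i) \<le> t * g1 b / h" if "i \<le> N" for i
    proof (rule ccontr)
      assume "\<not> g1 (e i) \<le> t * g1 b / h"
      then have "g1 c \<le> h * g1 (e i)" using le h by (simp add: g1_def field_simps)
      then have "g2 c \<le> H * g2 (e i)"
        using ratio_control[OF ctl Z(1,4,3) eZ[of i]] ea ed ne by (auto simp: g1_def g2_def)
      also have "\<dots> \<le> H * (L * (B ^ Suc i * g2 b))" using ehi H by (intro mult_left_mono) auto
      also have "\<dots> \<le> H * (L * (B ^ Suc N * g2 b))"
        using H L g that B by (intro mult_left_mono mult_right_mono power_increasing) auto
      also have "\<dots> = T * g2 b" by (simp add: T_def)
      finally show False using gt by simp
    qed
    define \<sigma> where "\<sigma> = inverted \<rho>1 a d"
    \<comment> \<open>The jump from \<open>e i\<close> to \<open>e j\<close> makes their inverted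
      \<open>\<rho>2\<close>-distance exceed \<open>H * g2 (e i)\<close>. The weak condition read
      backwards then bounds their inverted \<open>\<rho>1\<close>-distance from below.\<close>
    have sep0: "h\<^sup>2 * g1 b \<le> \<sigma> (e i) (e j)" if ij: "i < j" for i j
    proof -
      have "2 * H * K2\<^sup>2 * g2 (e i) \<le> 2 * H * K2\<^sup>2 * (L * (B ^ Suc i * g2 b))"
        using ehi H by (intro mult_left_mono) auto
      also have "\<dots> = B ^ Suc (Suc i) * g2 b" by (simp add: B_def)
      also have "\<dots> \<le> B ^ Suc j * g2 b"
        using ij B g by (intro mult_right_mono power_increasing) auto
      also have "\<dots> \<le> g2 (e j)" by (rule elo)
      finally have big: "2 * H * K2\<^sup>2 * g2 (e i) \<le> g2 (e j)" .
      have "K2\<^sup>2 < 2 * H * K2\<^sup>2" using mult_right_mono[OF H, of "K2\<^sup>2"] K2 by linarith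
      then have "K2\<^sup>2 * g2 (e i) < 2 * H * K2\<^sup>2 * g2 (e i)" using e2 by (rule mult_strict_right_mono)
      then have "g2 (e j) \<le> K2\<^sup>2 * inverted \<rho>2 a d (e i) (e j)"
        using B.ratio_le_inverted[OF Z(1,4) eZ[of i] eZ[of j]] ed big
        by (auto simp: g2_def max_def split: if_splits)
      then have "K2\<^sup>2 * (2 * H * g2 (e i)) \<le> K2\<^sup>2 * inverted \<rho>2 a d (e i) (e j)"
        using big by (simp add: mult.assoc mult.left_commute)
      then have "2 * H * g2 (e i) \<le> inverted \<rho>2 a d (e i) (e j)"
        by (rule mult_left_le_imp_le) (use K2 in linarith)
      moreover have "0 < H * g2 (e i)" using H e2[of i] by simp
      ultimately have "\<not> inverted \<rho>2 a d (e i) (e j) \<le> H * g2 (e i)" by linarith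
      then have "\<not> \<sigma> (e i) (e j) \<le> h * g1 (e i)"
        using inverted_control[OF ctl Z(1,4) eZ[of i] eZ[of j]] ea ed by (auto simp: \<sigma>_def g1_def g2_def)
      moreover have "h * (h * g1 b) \<le> h * g1 (e i)" using lo1[of i] h by (intro mult_left_mono) auto
      ultimately show ?thesis by (simp add: power2_eq_square mult_ac)
    qed
    have sep: "h\<^sup>2 * g1 b \<le> \<sigma> (e i) (e j)" if "i \<noteq> j" for i j
      using that sep0[of i j] sep0[of j i] A.inverted_sym[OF eZ[of i] eZ[of j]]
      by (cases "i < j") (auto simp: \<sigma>_def)
    have upper: "\<sigma> (e i) (e j) \<le> K1\<^sup>2 * (t * g1 b / h)" if "i \<le> N" "j \<le> N" for i j
    proof -
      have "\<sigma> (e i) (e j) \<le> K1\<^sup>2 * max (g1 (e i)) (g1 (e j))"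
        unfolding \<sigma>_def g1_def by (intro A.inverted_le eZ ed Z)
      also have "\<dots> \<le> K1\<^sup>2 * (t * g1 b / h)" using hi1 that by (intro mult_left_mono) auto
      finally show ?thesis .
    qed
    have D: "0 < \<rho>1 a d" using Z ne A.pos by auto
    have w: "0 < \<rho>1 d (e i)" for i using Z ed eZ A.pos by metis
    have \<rho>: "\<rho>1 (e i) (e j) = \<sigma> (e i) (e j) * (\<rho>1 d (e i) * \<rho>1 d (e j) / \<rho>1 a d)" for i j
      using D w[of i] w[of j] by (simp add: \<sigma>_def inverted_def)
    have \<sigma>0: "0 \<le> \<sigma> (e i) (e j)" for i j
      using A.nonneg eZ D w[of i] w[of j] by (simp add: \<sigma>_def inverted_def)
    have lo: "0 < h\<^sup>2 * g1 b" using h g by simp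
    have inj: "inj_on e {..N}"
    proof (rule inj_onI, rule ccontr)
      fix i j assume "e i = e j" "i \<noteq> j"
      then have "h\<^sup>2 * g1 b \<le> \<sigma> (e i) (e i)" using sep by metis
      then show False using lo eZ by (simp add: \<sigma>_def inverted_def)
    qed
    have "card (e ` {..N}) \<le> N"
    proof (rule N[rule_format])
      show "finite (e ` {..N}) \<and> e ` {..N} \<subseteq> Z" using eZ by auto
      fix p q r s assume "p \<in> e ` {..N}" "q \<in> e ` {..N}" "r \<in> e ` {..N}" "s \<in> e ` {..N}"
        and pq: "p \<noteq> q" and rs: "r \<noteq> s"
      then obtain i j k l where ijkl: "p = e i" "q = e j" "r = e k" "s = e l"
        "i \<le> N" "j \<le> N" "k \<le> N" "l \<le> N" by auto
      \<comment> \<open>Each of the four points occurs once in either product, so passing from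
        inverted distances to \<open>\<rho>1\<close> multiplies both sides by the same
        weight.\<close>
      define W where "W = (\<rho>1 d (e i) * \<rho>1 d (e j) * (\<rho>1 d (e k) * \<rho>1 d (e l))) / (\<rho>1 a d * \<rho>1 a d)"
      have W: "0 \<le> W" using D w[of i] w[of j] w[of k] w[of l] by (simp add: W_def)
      have "\<sigma> p r * \<sigma> q s \<le> (K1\<^sup>2 * (t * g1 b / h)) * (K1\<^sup>2 * (t * g1 b / h))"
        using ijkl upper \<sigma>0 h t g by (intro mult_mono) auto
      also have "\<dots> = M * (h\<^sup>2 * g1 b * (h\<^sup>2 * g1 b))"
        using h by (simp add: M_def power2_eq_square power3_eq_cube)
      also have "\<dots> \<le> M * (\<sigma> p q * \<sigma> r s)"
        using ijkl sep[of i j] sep[of k l] \<sigma>0 lo pq rs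
        by (intro mult_left_mono mult_mono) (auto simp: M_def)
      finally have "\<sigma> p r * \<sigma> q s * W \<le> M * (\<sigma> p q * \<sigma> r s) * W" using W by (rule mult_right_mono)
      then show "\<rho>1 p r * \<rho>1 q s \<le> M * (\<rho>1 p q * \<rho>1 r s)"
        unfolding ijkl \<rho> by (simp add: W_def mult_ac)
    qed
    then show False using card_image[OF inj] by simp
  qed
  then show ?thesis using T by (intro exI[of _ T] conjI cross_controlI) auto
qed

text \<open>Perfectness of \<open>\<rho>1\<close> joins \<open>c\<close> to \<open>b\<close> by
  points whose ratio at least halves at each step. A step costs a factor \<open>T\<close> for
  \<open>\<rho>2\<close>, and the number of steps is logarithmic in \<open>u\<close>.\<close>

lemma control_power:
  assumes perf: "moebius_perfect Z \<rho>1"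
    and ctl: "\<And>t. 1 \<le> t \<Longrightarrow> \<exists>T\<ge>1. cross_control Z \<rho>1 \<rho>2 t T"
  shows "\<exists>n\<ge>1. \<forall>u\<ge>1. cross_control Z \<rho>1 \<rho>2 u ((4 * u) ^ n)"
proof -
  obtain L where L: "L \<ge> 1" and mp: "\<And>a d l. a \<in> Z \<Longrightarrow> d \<in> Z \<Longrightarrow> a \<noteq> d \<Longrightarrow> 0 < l \<Longrightarrow>
      \<exists>x\<in>Z. x \<noteq> a \<and> x \<noteq> d \<and> l \<le> ratio \<rho>1 a d x \<and> ratio \<rho>1 a d x \<le> L * l"
    using perf[unfolded A.moebius_perfect_iff_ratio] by auto
  \<comment> \<open>The next point is sought in the window from
    \<open>ratio \<rho>1 a d c / (2 * L)\<close> to half of \<open>ratio \<rho>1 a d c\<close>; the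
    bound \<open>2 * L\<close> covers the drop.\<close>
  obtain T where T: "1 \<le> T" and cT: "cross_control Z \<rho>1 \<rho>2 (2 * L) T"
    using ctl[of "2 * L"] L by auto
  \<comment> \<open>Once \<open>T \<le> 2 ^ n\<close>, the cost \<open>T ^ Suc k\<close> is at most
    \<open>(2 * 2 ^ k) ^ n\<close>, and the least \<open>k\<close> with \<open>u \<le> 2 ^ k\<close>
    turns this into \<open>(4 * u) ^ n\<close>.\<close>
  obtain n0 where n0: "T < 2 ^ n0" using real_arch_pow[of 2 T] by auto
  define n where "n = max 1 n0"
  have "(2::real) ^ n0 \<le> 2 ^ n" by (intro power_increasing) (auto simp: n_def)
  then have n: "1 \<le> n" "T \<le> 2 ^ n" using n0 n_def by linarith+
  have chain: "ratio \<rho>2 a d c \<le> T ^ Suc k * ratio \<rho>2 a d b"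
    if "a \<in> Z" "b \<in> Z" "d \<in> Z" "a \<noteq> d" "b \<noteq> a" "b \<noteq> d" "c \<in> Z" "c \<noteq> a" "c \<noteq> d"
      "ratio \<rho>1 a d c \<le> 2 ^ k * ratio \<rho>1 a d b" for a b c d k
    using that
  proof (induction k arbitrary: c)
    case 0
    have "1 * ratio \<rho>1 a d b \<le> 2 * L * ratio \<rho>1 a d b"
      using 0 L A.ratio_nonneg by (intro mult_right_mono) auto
    then have "ratio \<rho>1 a d c \<le> 2 * L * ratio \<rho>1 a d b" using 0 by simp
    then show ?case using ratio_control[OF cT, of a d c b] 0 by simp
  next
    case (Suc k)
    have "0 < ratio \<rho>1 a d c" using Suc.prems A.ratio_pos by simp
    then obtain x where x: "x \<in> Z" "x \<noteq> a" "x \<noteq> d" "ratio \<rho>1 a d c / (2 * L) \<le> ratio \<rho>1 a d x"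
        "ratio \<rho>1 a d x \<le> L * (ratio \<rho>1 a d c / (2 * L))"
      using mp[of a d "ratio \<rho>1 a d c / (2 * L)"] Suc.prems L by auto
    have "ratio \<rho>2 a d c \<le> T * ratio \<rho>2 a d x"
      using ratio_control[OF cT, of a d c x] Suc.prems x L by (simp add: field_simps)
    also have "\<dots> \<le> T * (T ^ Suc k * ratio \<rho>2 a d b)"
      using Suc.prems x L T by (intro mult_left_mono Suc.IH) auto
    finally show ?case by simp
  qed
  have "cross_control Z \<rho>1 \<rho>2 u ((4 * u) ^ n)" if u: "1 \<le> u" for u
  proof (rule cross_controlI)
    show "1 \<le> (4 * u) ^ n" using u by (intro one_le_power) auto
    then show "0 \<le> (4 * u) ^ n" by linarith
    obtain k where k: "u \<le> 2 ^ k" "2 ^ k \<le> 2 * u"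
    proof -
      define k where "k = (LEAST k. u \<le> (2::real) ^ k)"
      have ex: "\<exists>k. u \<le> (2::real) ^ k" using real_arch_pow[of 2 u] by (auto intro: less_imp_le)
      have "u \<le> 2 ^ k" unfolding k_def using ex by (rule LeastI_ex)
      moreover have "2 ^ k \<le> 2 * u"
      proof (cases k)
        case (Suc m)
        then have "\<not> u \<le> 2 ^ m" using not_less_Least[of m "\<lambda>k. u \<le> (2::real) ^ k"] k_def by simp
        then show ?thesis using Suc by simp
      qed (use u in simp)
      ultimately show ?thesis using that by blast
    qed
    have "T ^ Suc k \<le> (2 ^ n) ^ Suc k" using T n by (intro power_mono) auto
    also have "\<dots> = (2 * 2 ^ k) ^ n" by (simp add: power_mult_distrib mult.commute flip: power_mult)
    also have "\<dots> \<le> (4 * u) ^ n" using k by (intro power_mono) auto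
    finally have Tk: "T ^ Suc k \<le> (4 * u) ^ n" .
    fix a b c d assume Z: "a \<in> Z" "b \<in> Z" "c \<in> Z" "d \<in> Z" "distinct [a, b, c, d]"
      and le: "ratio \<rho>1 a d c \<le> u * ratio \<rho>1 a d b"
    have "u * ratio \<rho>1 a d b \<le> 2 ^ k * ratio \<rho>1 a d b"
      using k Z A.ratio_nonneg by (intro mult_right_mono) auto
    then have "ratio \<rho>2 a d c \<le> T ^ Suc k * ratio \<rho>2 a d b"
      using le Z by (intro chain) auto
    also have "\<dots> \<le> (4 * u) ^ n * ratio \<rho>2 a d b"
      using Tk Z B.ratio_nonneg by (intro mult_right_mono) auto
    finally show "ratio \<rho>2 a d c \<le> (4 * u) ^ n * ratio \<rho>2 a d b" .
  qed
  then show ?thesis using n by blast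
qed

text \<open>The power term serves the case where the \<open>\<rho>2\<close>-ratio does not drop from
  \<open>b\<close> to \<open>c\<close>. The root term comes from the reverse control and makes the
  bound tend to 0 with \<open>t\<close>.\<close>

lemma control_two_sided_power:
  assumes n: "1 \<le> n"
    and c12: "\<And>u. 1 \<le> u \<Longrightarrow> cross_control Z \<rho>1 \<rho>2 u ((4 * u) ^ n)"
    and c21: "\<And>u. 1 \<le> u \<Longrightarrow> cross_control Z \<rho>2 \<rho>1 u ((4 * u) ^ n)"
    and t: "0 \<le> t"
  shows "cross_control Z \<rho>1 \<rho>2 t ((4 ^ Suc n * t) ^ n + 4 * root n t)"
proof (rule cross_controlI)
  interpret flipped: quasi_metric_pair Z \<rho>2 K2 \<rho>1 K1 by (rule flip)
  have nn: "0 \<le> (4 ^ Suc n * t) ^ n" "0 \<le> 4 * root n t" using t n by auto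
  then show "0 \<le> (4 ^ Suc n * t) ^ n + 4 * root n t" by linarith
  show "1 \<le> (4 ^ Suc n * t) ^ n + 4 * root n t" if "1 \<le> t"
  proof -
    have "1 \<le> root n t" using that n by simp
    then show ?thesis using nn by linarith
  qed
  fix a b c d assume Z: "a \<in> Z" "b \<in> Z" "c \<in> Z" "d \<in> Z" and ne: "distinct [a, b, c, d]"
    and le: "ratio \<rho>1 a d c \<le> t * ratio \<rho>1 a d b"
  have p: "0 < ratio \<rho>1 a d b" "0 < ratio \<rho>1 a d c" "0 < ratio \<rho>2 a d b" "0 < ratio \<rho>2 a d c"
    using Z ne A.ratio_pos B.ratio_pos by auto
  show "ratio \<rho>2 a d c \<le> ((4 ^ Suc n * t) ^ n + 4 * root n t) * ratio \<rho>2 a d b"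
  proof (cases "ratio \<rho>2 a d b \<le> ratio \<rho>2 a d c")
    \<comment> \<open>The reverse control at 1 forces \<open>4 ^ n * t \<ge> 1\<close>, so the
      forward control applies with \<open>4 ^ n * t\<close> even when \<open>t\<close> is below
      1.\<close>
    case True
    then have "ratio \<rho>1 a d b \<le> 4 ^ n * ratio \<rho>1 a d c"
      using flipped.ratio_control[OF c21[of 1], of a d b c] Z ne by auto
    also have "\<dots> \<le> 4 ^ n * (t * ratio \<rho>1 a d b)" using le by (intro mult_left_mono) auto
    finally have u: "1 \<le> 4 ^ n * t" using p by simp
    have "1 \<le> (4::real) ^ n" by simp
    then have "t \<le> 4 ^ n * t" using t mult_right_mono[of 1 "4 ^ n" t] by simp
    then have "t * ratio \<rho>1 a d b \<le> 4 ^ n * t * ratio \<rho>1 a d b" using p by (intro mult_right_mono) auto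
    then have "ratio \<rho>2 a d c \<le> (4 * (4 ^ n * t)) ^ n * ratio \<rho>2 a d b"
      using ratio_control[OF c12[OF u], of a d c b] Z ne le by auto
    also have "\<dots> \<le> ((4 ^ Suc n * t) ^ n + 4 * root n t) * ratio \<rho>2 a d b"
      using p nn by (intro mult_right_mono) (auto simp: mult.assoc)
    finally show ?thesis .
  next
    case False
    \<comment> \<open>The reverse control at the drop \<open>u\<close> gives
      \<open>1 \<le> (4 * u) ^ n * t\<close>; the \<open>n\<close>-th root of this bounds
      \<open>1 / u\<close> by \<open>4 * root n t\<close>.\<close>
    define u where "u = ratio \<rho>2 a d b / ratio \<rho>2 a d c"
    have u: "1 \<le> u" "ratio \<rho>2 a d b = u * ratio \<rho>2 a d c" using False p by (auto simp: u_def)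
    then have "ratio \<rho>1 a d b \<le> (4 * u) ^ n * ratio \<rho>1 a d c"
      using flipped.ratio_control[OF c21[of u], of a d b c] Z ne by auto
    also have "\<dots> \<le> (4 * u) ^ n * (t * ratio \<rho>1 a d b)" using le u by (intro mult_left_mono) auto
    finally have "1 \<le> (4 * u) ^ n * t" using p by simp
    then have "1 \<le> root n ((4 * u) ^ n * t)" using n by simp
    also have "\<dots> = 4 * u * root n t" using n u by (simp add: real_root_mult real_root_power_cancel)
    finally have "1 * ratio \<rho>2 a d c \<le> 4 * u * root n t * ratio \<rho>2 a d c"
      using p by (intro mult_right_mono) auto
    also have "\<dots> = 4 * root n t * ratio \<rho>2 a d b" by (simp add: u(2))
    also have "\<dots> \<le> ((4 ^ Suc n * t) ^ n + 4 * root n t) * ratio \<rho>2 a d b"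
      using p nn by (intro mult_right_mono) auto
    finally show ?thesis by simp
  qed
qed

section \<open>Transfer of doubling and perfectness to the second quasi-metric\<close>

text \<open>By \<open>control_inverse\<close>, control with target \<open>1 / (2 * M)\<close> turns
  a bound \<open>M\<close> on cross ratios for \<open>\<rho>2\<close> into a bound for
  \<open>\<rho>1\<close>, where doubling applies.\<close>

lemma moebius_doubling_transfer:
  assumes doub: "moebius_doubling Z \<rho>1"
    and small: "\<And>\<epsilon>. 0 < \<epsilon> \<Longrightarrow> \<exists>s>0. cross_control Z \<rho>1 \<rho>2 s \<epsilon>"
  shows "moebius_doubling Z \<rho>2"
  unfolding moebius_doubling_def
proof
  fix M0 :: real
  define M where "M = max 1 M0"
  have M: "1 \<le> M" "M0 \<le> M" by (auto simp: M_def)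
  obtain s where s: "0 < s" and ctl: "cross_control Z \<rho>1 \<rho>2 s (1 / (2 * M))"
    using small[of "1 / (2 * M)"] M by auto
  from control_inverse[OF ctl s] have inv: "cross_control Z \<rho>2 \<rho>1 M (1 / s)" using M by simp
  from doub[unfolded moebius_doubling_def, THEN spec, of "1 / s"]
  obtain N where N: "\<forall>S. finite S \<and> S \<subseteq> Z \<longrightarrow>
        (\<forall>a\<in>S. \<forall>b\<in>S. \<forall>c\<in>S. \<forall>d\<in>S. a \<noteq> b \<longrightarrow> c \<noteq> d \<longrightarrow>
           \<rho>1 a c * \<rho>1 b d \<le> 1 / s * (\<rho>1 a b * \<rho>1 c d)) \<longrightarrow> card S \<le> N" ..
  show "\<exists>N::nat. \<forall>S. finite S \<and> S \<subseteq> Z \<longrightarrow>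
        (\<forall>a\<in>S. \<forall>b\<in>S. \<forall>c\<in>S. \<forall>d\<in>S. a \<noteq> b \<longrightarrow> c \<noteq> d \<longrightarrow>
           \<rho>2 a c * \<rho>2 b d \<le> M0 * (\<rho>2 a b * \<rho>2 c d)) \<longrightarrow> card S \<le> N"
  proof (intro exI[of _ N] allI impI)
    fix S assume S: "finite S \<and> S \<subseteq> Z" and cr: "\<forall>a\<in>S. \<forall>b\<in>S. \<forall>c\<in>S. \<forall>d\<in>S. a \<noteq> b \<longrightarrow> c \<noteq> d \<longrightarrow>
           \<rho>2 a c * \<rho>2 b d \<le> M0 * (\<rho>2 a b * \<rho>2 c d)"
    show "card S \<le> N"
    proof (rule N[rule_format, OF S])
      fix a b c d assume abcd: "a \<in> S" "b \<in> S" "c \<in> S" "d \<in> S" "a \<noteq> b" "c \<noteq> d"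
      then have Z: "a \<in> Z" "b \<in> Z" "c \<in> Z" "d \<in> Z" using S by auto
      have "\<rho>2 a c * \<rho>2 b d \<le> M0 * (\<rho>2 a b * \<rho>2 c d)" using cr abcd by blast
      also have "\<dots> \<le> M * (\<rho>2 a b * \<rho>2 c d)"
        using M Z by (intro mult_right_mono mult_nonneg_nonneg B.nonneg) auto
      finally show "\<rho>1 a c * \<rho>1 b d \<le> 1 / s * (\<rho>1 a b * \<rho>1 c d)"
        using quasi_metric_pair.cross_controlD[OF flip inv] Z abcd by blast
    qed
  qed
qed

text \<open>A discrete intermediate value argument: along points whose \<open>\<rho>1\<close>-ratios
  grow geometrically, the \<open>\<rho>2\<close>-ratio starts below \<open>l\<close>, reaches
  \<open>l\<close> eventually, and never rises by more than a factor \<open>T\<close> in one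
  step.\<close>

lemma moebius_perfect_transfer:
  assumes perf: "moebius_perfect Z \<rho>1"
    and small: "\<And>\<epsilon>. 0 < \<epsilon> \<Longrightarrow> \<exists>s>0. cross_control Z \<rho>1 \<rho>2 s \<epsilon>"
    and large: "\<And>t. 0 \<le> t \<Longrightarrow> \<exists>T. cross_control Z \<rho>1 \<rho>2 t T"
  shows "moebius_perfect Z \<rho>2"
proof -
  obtain L where L: "L \<ge> 1" and mp: "\<And>a d l. a \<in> Z \<Longrightarrow> d \<in> Z \<Longrightarrow> a \<noteq> d \<Longrightarrow> 0 < l \<Longrightarrow>
      \<exists>x\<in>Z. x \<noteq> a \<and> x \<noteq> d \<and> l \<le> ratio \<rho>1 a d x \<and> ratio \<rho>1 a d x \<le> L * l"
    using perf[unfolded A.moebius_perfect_iff_ratio] by auto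
  obtain T0 where "cross_control Z \<rho>1 \<rho>2 (2 * L) T0" using large[of "2 * L"] L by auto
  then obtain T where T: "1 \<le> T" and cT: "cross_control Z \<rho>1 \<rho>2 (2 * L) T"
    using control_mono[of "2 * L" T0 "max 1 T0"] max.cobounded1 max.cobounded2 by blast
  have "\<exists>x\<in>Z. x \<noteq> a \<and> x \<noteq> d \<and> l \<le> ratio \<rho>2 a d x \<and> ratio \<rho>2 a d x \<le> T * l"
    if Z: "a \<in> Z" "d \<in> Z" "a \<noteq> d" and l: "0 < l" for a d l
  proof -
    define g1 where "g1 = ratio \<rho>1 a d"
    define g2 where "g2 = ratio \<rho>2 a d"
    obtain b where b: "b \<in> Z" "b \<noteq> a" "b \<noteq> d" using mp[OF Z, of 1] by auto
    have g: "0 < g1 b" "0 < g2 b" using Z b A.ratio_pos B.ratio_pos by (auto simp: g1_def g2_def)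
    obtain s where s: "0 < s" and cs: "cross_control Z \<rho>1 \<rho>2 s (l / (2 * g2 b))"
      using small[of "l / (2 * g2 b)"] l g by auto
    obtain s' where s': "0 < s'" and cs': "cross_control Z \<rho>1 \<rho>2 s' (g2 b / l)"
      using small[of "g2 b / l"] l g by auto
    \<comment> \<open>The window for \<open>x 0\<close> then ends at \<open>s * g1 b\<close>, so the
      choice of \<open>s\<close> gives \<open>g2 (x 0) \<le> l / 2\<close>.\<close>
    define l0 where "l0 = s * g1 b / L"
    have l0: "0 < l0" using s g L by (simp add: l0_def)
    have "\<exists>x\<in>Z. x \<noteq> a \<and> x \<noteq> d \<and> l0 * 2 ^ i \<le> g1 x \<and> g1 x \<le> L * (l0 * 2 ^ i)" for i
      unfolding g1_def using mp[of a d "l0 * 2 ^ i"] Z l0 by simp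
    then obtain x where xZ: "\<And>i. x i \<in> Z" and xa: "\<And>i. x i \<noteq> a" and xd: "\<And>i. x i \<noteq> d"
      and xlo: "\<And>i. l0 * 2 ^ i \<le> g1 (x i)" and xhi: "\<And>i. g1 (x i) \<le> L * (l0 * 2 ^ i)"
      by metis
    have "g1 (x 0) \<le> s * g1 b" using xhi[of 0] L by (simp add: l0_def)
    then have "g2 (x 0) \<le> l / (2 * g2 b) * g2 b"
      using ratio_control[OF cs Z(1,2) xZ[of 0] b(1)] xd b by (auto simp: g1_def g2_def)
    then have x0: "g2 (x 0) < l" using g l by simp
    obtain n where "g1 b / (s' * l0) < 2 ^ n" using real_arch_pow[of 2 "g1 b / (s' * l0)"] by auto
    then have "g1 b < s' * (l0 * 2 ^ n)" using s' l0 by (simp add: field_simps)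
    also have "\<dots> \<le> s' * g1 (x n)" using xlo s' by (intro mult_left_mono) auto
    finally have "g2 b \<le> g2 b / l * g2 (x n)"
      using ratio_control[OF cs' Z(1,2) b(1) xZ[of n]] xa xd b by (auto simp: g1_def g2_def)
    then have ex: "\<exists>n. l \<le> g2 (x n)" using g l by (intro exI[of _ n]) (simp add: field_simps)
    \<comment> \<open>The first index at which \<open>l\<close> is reached is not 0 by
      \<open>x0\<close>, so it has a predecessor whose value is still below
      \<open>l\<close>.\<close>
    define m where "m = (LEAST n. l \<le> g2 (x n))"
    have m: "l \<le> g2 (x m)" unfolding m_def using ex by (rule LeastI_ex)
    then obtain k where k: "m = Suc k" using x0 by (cases m) auto
    then have "g2 (x k) < l" using not_less_Least[of k "\<lambda>n. l \<le> g2 (x n)"] m_def by simp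
    have "g1 (x m) \<le> 2 * L * (l0 * 2 ^ k)" using xhi[of m] by (simp add: k)
    also have "\<dots> \<le> 2 * L * g1 (x k)" using xlo L by (intro mult_left_mono) auto
    finally have "g2 (x m) \<le> T * g2 (x k)"
      using ratio_control[OF cT Z(1,2) xZ[of m] xZ[of k]] xa xd by (auto simp: g1_def g2_def)
    also have "\<dots> \<le> T * l" using T \<open>g2 (x k) < l\<close> by (intro mult_left_mono) auto
    finally show ?thesis using m xZ xa xd unfolding g2_def by blast
  qed
  then show ?thesis unfolding B.moebius_perfect_iff_ratio using T by blast
qed

end

section \<open>Homeomorphisms of the half line\<close>

text \<open>The root term makes the function strictly increasing. The power term makes it unbounded,
  as its value at \<open>u = max 1 y\<close> is at least \<open>y\<close>, and the intermediate
  value theorem gives surjectivity.\<close>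

lemma homeomorphism_power_plus_root:
  fixes A :: real
  assumes n: "1 \<le> n" and A: "1 \<le> A"
  shows "\<exists>\<theta>'. homeomorphism {0..} {0..} (\<lambda>t. (A * t) ^ n + 4 * root n t) \<theta>'"
proof (rule homeomorphism_into_1d)
  let ?\<theta> = "\<lambda>t. (A * t) ^ n + 4 * root n t"
  show "path_connected {0::real..}" by (simp add: convex_imp_path_connected)
  show cont: "continuous_on {0..} ?\<theta>" by (intro continuous_intros)
  have mono: "?\<theta> s < ?\<theta> t" if "0 \<le> s" "s < t" for s t
  proof -
    have "(A * s) ^ n \<le> (A * t) ^ n" using that A by (intro power_mono mult_left_mono) auto
    moreover have "root n s < root n t" using n that by simp
    ultimately show ?thesis by simp
  qed
  show "inj_on ?\<theta> {0..}"
  proof (rule linorder_inj_onI)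
    fix s t :: real assume "s < t" "s \<in> {0..}" "t \<in> {0..}"
    then show "?\<theta> s \<noteq> ?\<theta> t" using mono[of s t] by auto
  qed auto
  show "?\<theta> ` {0..} = {0..}"
  proof (intro equalityI subsetI)
    fix y assume "y \<in> ?\<theta> ` {0..}"
    then show "y \<in> {0..}" using A n by auto
  next
    fix y :: real assume y: "y \<in> {0..}"
    define u where "u = max 1 y"
    have u: "1 \<le> u" "y \<le> u" by (auto simp: u_def)
    then have Au: "u \<le> A * u" using mult_right_mono[OF A, of u] by simp
    then have "A * u \<le> (A * u) ^ n" using n u by (intro self_le_power) linarith+
    moreover have "0 \<le> root n u" using n u by simp
    ultimately have "y \<le> ?\<theta> u" using Au u by linarith
    moreover have "?\<theta> 0 \<le> y" using n y by (simp add: zero_power)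
    ultimately obtain x where "0 \<le> x" "?\<theta> x = y"
      using IVT'[of ?\<theta> 0 y u] u continuous_on_subset[OF cont, of "{0..u}"] by force
    then show "y \<in> ?\<theta> ` {0..}" by auto
  qed
qed

text \<open>At most one of \<open>\<epsilon>\<close> and \<open>\<epsilon> / 2\<close> is the value
  at 0; the preimage of the other is positive.\<close>

lemma homeomorphism_halfline_small_value:
  assumes "homeomorphism {0::real..} {0::real..} \<theta> \<theta>'" and \<epsilon>: "0 < \<epsilon>"
  shows "\<exists>s>0. \<theta> s \<le> \<epsilon>"
proof -
  have inv: "0 \<le> \<theta>' y" "\<theta> (\<theta>' y) = y" if "0 \<le> y" for y
    using assms that unfolding homeomorphism_def by auto
  show ?thesis
  proof (cases "\<theta>' \<epsilon> = 0")
    case False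
    then show ?thesis using inv[of \<epsilon>] \<epsilon> by (intro exI[of _ "\<theta>' \<epsilon>"]) auto
  next
    case True
    then have "\<theta>' (\<epsilon> / 2) \<noteq> 0" using inv(2)[of \<epsilon>] inv(2)[of "\<epsilon> / 2"] \<epsilon> by auto
    then show ?thesis using inv[of "\<epsilon> / 2"] \<epsilon> by (intro exI[of _ "\<theta>' (\<epsilon> / 2)"]) auto
  qed
qed

section \<open>Pulling the quasi-metric of the image back along the map\<close>

lemma moebius_perfect_image:
  "moebius_perfect (f ` Z) \<rho> \<longleftrightarrow> moebius_perfect Z (\<lambda>x y. \<rho> (f x) (f y))" if "inj_on f Z"
  unfolding moebius_perfect_def using that by (simp add: inj_on_eq_iff cong: ball_cong)

lemma moebius_doubling_image:
  assumes "inj_on f Z"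
  shows "moebius_doubling (f ` Z) \<rho> \<longleftrightarrow> moebius_doubling Z (\<lambda>x y. \<rho> (f x) (f y))"
proof -
  \<comment> \<open>Finite subsets of the image are images of finite subsets of \<open>Z\<close>,
    and injectivity preserves their cardinality.\<close>
  have "(finite S \<and> S \<subseteq> Z \<longrightarrow>
      (\<forall>a\<in>f ` S. \<forall>b\<in>f ` S. \<forall>c\<in>f ` S. \<forall>d\<in>f ` S. a \<noteq> b \<longrightarrow> c \<noteq> d \<longrightarrow>
         \<rho> a c * \<rho> b d \<le> M * (\<rho> a b * \<rho> c d)) \<longrightarrow> card (f ` S) \<le> N) \<longleftrightarrow>
    (finite S \<and> S \<subseteq> Z \<longrightarrow>
      (\<forall>a\<in>S. \<forall>b\<in>S. \<forall>c\<in>S. \<forall>d\<in>S. a \<noteq> b \<longrightarrow> c \<noteq> d \<longrightarrow>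
         \<rho> (f a) (f c) * \<rho> (f b) (f d) \<le> M * (\<rho> (f a) (f b) * \<rho> (f c) (f d))) \<longrightarrow> card S \<le> N)"
    for S M N
  proof (cases "S \<subseteq> Z")
    case True
    then have inj: "inj_on f S" using assms inj_on_subset by blast
    show ?thesis by (simp add: card_image[OF inj] inj_on_eq_iff[OF inj] cong: ball_cong)
  qed simp
  then show ?thesis unfolding moebius_doubling_def all_finite_subset_image by (simp only:)
qed

theorem theorem1p1:
  fixes Z1 :: "'a set" and \<rho>1 :: "'a \<Rightarrow> 'a \<Rightarrow> real"
    and Z2 :: "'b set" and \<rho>2 :: "'b \<Rightarrow> 'b \<Rightarrow> real"
    and f :: "'a \<Rightarrow> 'b"
  assumes "quasi_metric_space Z1 \<rho>1"
    and "uniformly_perfect Z1 \<rho>1"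
    and "doubling Z1 \<rho>1"
    and "quasi_metric_space Z2 \<rho>2"
    and "weakly_quasimobius Z1 \<rho>1 Z2 \<rho>2 f"
  shows "quasimobius Z1 \<rho>1 Z2 \<rho>2 f \<longleftrightarrow>
    uniformly_perfect (f ` Z1) \<rho>2 \<and> doubling (f ` Z1) \<rho>2"
proof -
  define \<rho> where "\<rho> = (\<lambda>x y. \<rho>2 (f x) (f y))"
  have emb: "embedding_map (qtopology Z1 \<rho>1) (qtopology Z2 \<rho>2) f"
    using assms(5) by (simp add: weakly_quasimobius_def)
  then have hom: "homeomorphic_map (qtopology Z1 \<rho>1) (subtopology (qtopology Z2 \<rho>2) (f ` Z1)) f"
    by (simp add: embedding_map_def)
  have inj: "inj_on f Z1" using homeomorphic_imp_injective_map[OF hom] by simp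
  have sub: "f ` Z1 \<subseteq> Z2" 
    using homeomorphic_imp_surjective_map[OF hom] unfolding topspace_subtopology topspace_qtopology by blast
  obtain K1 where K1: "quasi_metric Z1 \<rho>1 K1" using assms(1) quasi_metric_space_iff by blast
  obtain K2 where K2: "quasi_metric Z2 \<rho>2 K2" using assms(4) quasi_metric_space_iff by blast
  interpret A: quasi_metric Z1 \<rho>1 K1 by (rule K1)
  interpret W: quasi_metric Z2 \<rho>2 K2 by (rule K2)
  have fZ: "f x \<in> Z2" if "x \<in> Z1" for x using that sub by blast
  interpret I: quasi_metric "f ` Z1" \<rho>2 K2
    using W.nonneg W.sym W.zero_iff W.K_ge_1 W.triangle fZ by unfold_locales auto
  interpret B: quasi_metric Z1 \<rho> K2
    unfolding \<rho>_def
    using W.nonneg W.sym W.zero_iff W.K_ge_1 W.triangle fZ inj_on_eq_iff[OF inj]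
    by unfold_locales auto
  interpret P: quasi_metric_pair Z1 \<rho>1 K1 \<rho> K2 ..
  interpret Q: quasi_metric_pair Z1 \<rho> K2 \<rho>1 K1 ..
  have perf1: "moebius_perfect Z1 \<rho>1" and doub1: "moebius_doubling Z1 \<rho>1"
    using assms A.uniformly_perfect_iff A.doubling_iff by auto
  have perf2: "uniformly_perfect (f ` Z1) \<rho>2 \<longleftrightarrow> moebius_perfect Z1 \<rho>"
    unfolding I.uniformly_perfect_iff \<rho>_def by (rule moebius_perfect_image[OF inj])
  have doub2: "doubling (f ` Z1) \<rho>2 \<longleftrightarrow> moebius_doubling Z1 \<rho>"
    unfolding I.doubling_iff \<rho>_def by (rule moebius_doubling_image[OF inj])
  have control: "cross_control Z1 \<rho>1 \<rho> s t \<longleftrightarrow>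
    (\<forall>a\<in>Z1. \<forall>b\<in>Z1. \<forall>c\<in>Z1. \<forall>d\<in>Z1. a \<noteq> b \<longrightarrow> c \<noteq> d \<longrightarrow>
       cross_ratio \<rho>1 a b c d \<le> s \<longrightarrow> cross_ratio \<rho>2 (f a) (f b) (f c) (f d) \<le> t)" for s t
  proof -
    have "cross_ratio \<rho>1 a b c d \<le> s \<longleftrightarrow> \<rho>1 a c * \<rho>1 b d \<le> s * (\<rho>1 a b * \<rho>1 c d)"
      "cross_ratio \<rho>2 (f a) (f b) (f c) (f d) \<le> t \<longleftrightarrow> \<rho> a c * \<rho> b d \<le> t * (\<rho> a b * \<rho> c d)"
      if "a \<in> Z1" "b \<in> Z1" "c \<in> Z1" "d \<in> Z1" "a \<noteq> b" "c \<noteq> d" for a b c d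
      using that A.pos[of a b] A.pos[of c d] B.pos[of a b] B.pos[of c d]
      by (simp_all add: cross_ratio_def pos_divide_le_eq \<rho>_def)
    then show ?thesis unfolding cross_control_def by blast
  qed
  have weak: "\<exists>h>0. \<exists>H\<ge>1. cross_control Z1 \<rho>1 \<rho> h H"
    using assms(5) unfolding weakly_quasimobius_def control by blast
  have quasi: "quasimobius Z1 \<rho>1 Z2 \<rho>2 f \<longleftrightarrow>
    (\<exists>\<theta> \<theta>'. homeomorphism {0..} {0..} \<theta> \<theta>' \<and> (\<forall>t\<ge>0. cross_control Z1 \<rho>1 \<rho> t (\<theta> t)))"
  proof -
    have "(\<forall>a\<in>Z1. \<forall>b\<in>Z1. \<forall>c\<in>Z1. \<forall>d\<in>Z1. \<forall>t\<ge>0. a \<noteq> b \<longrightarrow> c \<noteq> d \<longrightarrow>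
        cross_ratio \<rho>1 a b c d \<le> t \<longrightarrow> cross_ratio \<rho>2 (f a) (f b) (f c) (f d) \<le> \<theta> t) \<longleftrightarrow>
      (\<forall>t\<ge>0. cross_control Z1 \<rho>1 \<rho> t (\<theta> t))" for \<theta>
      unfolding control by blast
    then show ?thesis unfolding quasimobius_def by (simp only: emb simp_thms)
  qed
  show ?thesis
    unfolding perf2 doub2
  proof
    assume "quasimobius Z1 \<rho>1 Z2 \<rho>2 f"
    then obtain \<theta> \<theta>' where \<theta>: "homeomorphism {0..} {0..} \<theta> \<theta>'"
      and ctl: "\<And>t. 0 \<le> t \<Longrightarrow> cross_control Z1 \<rho>1 \<rho> t (\<theta> t)" unfolding quasi by blast
    have small: "\<exists>s>0. cross_control Z1 \<rho>1 \<rho> s \<epsilon>" if "0 < \<epsilon>" for \<epsilon>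
      using homeomorphism_halfline_small_value[OF \<theta> that] ctl P.control_mono by (meson less_imp_le)
    show "moebius_perfect Z1 \<rho> \<and> moebius_doubling Z1 \<rho>"
      using P.moebius_perfect_transfer[OF perf1 small] P.moebius_doubling_transfer[OF doub1 small] ctl
      by blast
  next
    assume asm: "moebius_perfect Z1 \<rho> \<and> moebius_doubling Z1 \<rho>"
    obtain h H where h: "0 < h" "1 \<le> H" and ctl: "cross_control Z1 \<rho>1 \<rho> h H" using weak by blast
    have any: "\<exists>T\<ge>1. cross_control Z1 \<rho>1 \<rho> t T" if "1 \<le> t" for t
      using P.control_any_bound[OF ctl h] asm doub1 that by blast
    have "cross_control Z1 \<rho> \<rho>1 (1 / (2 * H)) (1 / h)"
      using P.control_inverse[OF ctl] h by simp
    \<comment> \<open>The bound is raised to at least 1, as \<open>control_any_bound\<close>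
      demands.\<close>
    then have ctl': "cross_control Z1 \<rho> \<rho>1 (1 / (2 * H)) (max 1 (1 / h))"
      by (rule Q.control_mono) simp
    \<comment> \<open>In this direction perfectness of \<open>\<rho>1\<close> and doubling of the
      pulled-back \<open>\<rho>\<close> are what is used.\<close>
    have any': "\<exists>T\<ge>1. cross_control Z1 \<rho> \<rho>1 t T" if "1 \<le> t" for t
      using Q.control_any_bound[OF ctl' _ _ perf1] h asm that by auto
    obtain n where n: "1 \<le> n" "\<And>u. 1 \<le> u \<Longrightarrow> cross_control Z1 \<rho>1 \<rho> u ((4 * u) ^ n)"
      using P.control_power[OF perf1 any] by blast
    obtain m where m: "1 \<le> m" "\<And>u. 1 \<le> u \<Longrightarrow> cross_control Z1 \<rho> \<rho>1 u ((4 * u) ^ m)"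
      using Q.control_power[OF _ any'] asm by blast
    \<comment> \<open>A common exponent for both directions; raising the exponent weakens the bounds
      because \<open>4 * u \<ge> 1\<close>.\<close>
    define k where "k = max n m"
    have k: "1 \<le> k" using n by (simp add: k_def)
    have le: "(4 * u) ^ n \<le> (4 * u) ^ k" "(4 * u) ^ m \<le> (4 * u) ^ k" if "1 \<le> u" for u :: real
      using that by (intro power_increasing; simp add: k_def)+
    have "cross_control Z1 \<rho>1 \<rho> t ((4 ^ Suc k * t) ^ k + 4 * root k t)" if "0 \<le> t" for t
      using k n m le that P.control_mono Q.control_mono by (intro P.control_two_sided_power) blast+
    moreover obtain \<theta>' where "homeomorphism {0..} {0..} (\<lambda>t. (4 ^ Suc k * t) ^ k + 4 * root k t) \<theta>'"
      using homeomorphism_power_plus_root[OF k, of "4 ^ Suc k"] one_le_power[of "4::real" "Suc k"] by auto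
    ultimately show "quasimobius Z1 \<rho>1 Z2 \<rho>2 f" unfolding quasi by blast
  qed
qed

end
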